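(* Let $Z\subset\mathbb{R}^d$ be a centrally symmetric convex body centered at the origin and $m\ge1$. Then $Z$ is an $m$-operanoid if and only if there exists a linear map $T:\mathbb{R}^d\to L^1([0,1],\mathbb{H}^m)$ such that $\|Tx\|_{L^1}=h_Z(x)$ for all $x\in\mathbb{R}^d$ (i.e., when $h_Z$ is a norm, the normed space $(\mathbb{R}^d,h_Z)$ is linearly isometric to a subspace of $L^1([0,1],\mathbb{H}^m)$).
   Context: $\mathbb{H}^m$ is the real Euclidean space of complex Hermitian $m\times m$ matrices, $\|A\|_1$ the trace norm (sum of absolute values of eigenvalues). $L^1([0,1],\mathbb{H}^m)$ is the space of (Lebesgue-)measurable functions $A:[0,1]\to\mathbb{H}^m$ with $\|A\|_{L^1}:=\int_0^1\|A(\omega)\|_1\,d\omega<\infty$ (modulo a.e. equality). The support function of a convex body $K$ is $h_K(u)=\max_{x\in K}\langle u,x\rangle$. An $m$-operatope in $\mathbb{R}^d$ is a centrally symmetric convex body $Z$ with $h_Z(u)=\langle v,u\rangle+\sum_{j=1}^N\|\sum_{i=1}^d u_iA_i^{(j)}\|_1$ for some $N\ge1$, $v\in\mathbb{R}^d$, $A_i^{(j)}\in\mathbb{H}^m$. An $m$-operanoid is a centrally symmetric convex body that is a Hausdorff-metric limit of $m$-operatopes. *)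

theory Defs
  imports "HOL-Analysis.Analysis" "HOL-Computational_Algebra.Polynomial"
begin

text \<open>Complex Hermitian m x m matrices, with m encoded as the cardinality of a finite type 'm.\<close>
definition hermitian :: "complex^'m^'m \<Rightarrow> bool" where
  "hermitian A \<longleftrightarrow> (\<forall>i j. A$i$j = cnj (A$j$i))"

definition char_poly_cart :: "complex^'m^'m \<Rightarrow> complex poly" where
  "char_poly_cart A = det (\<chi> i j. (if i = j then [:0, 1:] else 0) - [:A$i$j:])"

text \<open>Trace norm: sum of absolute values of the eigenvalues, counted with
  (algebraic) multiplicity. Intended for Hermitian matrices.\<close>
definition trace_norm :: "complex^'m^'m \<Rightarrow> real" where
  "trace_norm A = (\<Sum>z\<in>{z. poly (char_poly_cart A) z = 0}.
       real (order z (char_poly_cart A)) * cmod z)"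

definition support_fun :: "(real^'d) set \<Rightarrow> real^'d \<Rightarrow> real" where
  "support_fun K u = (SUP x\<in>K. x \<bullet> u)"

definition convex_body :: "(real^'d) set \<Rightarrow> bool" where
  "convex_body K \<longleftrightarrow> compact K \<and> convex K \<and> K \<noteq> {}"

definition centrally_symmetric :: "(real^'d) set \<Rightarrow> bool" where
  "centrally_symmetric K \<longleftrightarrow> (\<exists>c. \<forall>x. x \<in> K \<longleftrightarrow> (2::real) *\<^sub>R c - x \<in> K)"

definition operatope :: "'m::finite itself \<Rightarrow> (real^'d) set \<Rightarrow> bool" where
  "operatope _ Z \<longleftrightarrow> convex_body Z \<and> centrally_symmetric Z \<and>
     (\<exists>(N::nat) (v::real^'d) (A :: nat \<Rightarrow> 'd \<Rightarrow> complex^'m^'m).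
        N \<ge> 1 \<and> (\<forall>j<N. \<forall>i. hermitian (A j i)) \<and>
        (\<forall>u. support_fun Z u = v \<bullet> u + (\<Sum>j<N. trace_norm (\<Sum>i\<in>UNIV. (u$i) *\<^sub>R A j i))))"

definition hausdorff_dist :: "'a::metric_space set \<Rightarrow> 'a set \<Rightarrow> real" where
  "hausdorff_dist A B = max (SUP a\<in>A. infdist a B) (SUP b\<in>B. infdist b A)"

definition operanoid :: "'m::finite itself \<Rightarrow> (real^'d) set \<Rightarrow> bool" where
  "operanoid t Z \<longleftrightarrow> convex_body Z \<and> centrally_symmetric Z \<and>
     (\<exists>S :: nat \<Rightarrow> (real^'d) set. (\<forall>k. operatope t (S k)) \<and>
        (\<lambda>k. hausdorff_dist (S k) Z) \<longlonglongrightarrow> 0)"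

text \<open>Representatives of elements of L^1([0,1], H^m): measurable, Hermitian-valued
  on [0,1], with integrable trace norm.\<close>
definition L1_herm :: "(real \<Rightarrow> complex^'m^'m) \<Rightarrow> bool" where
  "L1_herm f \<longleftrightarrow> f \<in> borel_measurable (lebesgue_on {0..1}) \<and>
     (\<forall>\<omega>\<in>{0..1}. hermitian (f \<omega>)) \<and>
     integrable (lebesgue_on {0..1}) (\<lambda>\<omega>. trace_norm (f \<omega>))"

definition L1_norm :: "(real \<Rightarrow> complex^'m^'m) \<Rightarrow> real" where
  "L1_norm f = integral\<^sup>L (lebesgue_on {0..1}) (\<lambda>\<omega>. trace_norm (f \<omega>))"

text \<open>Linearity of a map into L^1, i.e. modulo a.e. equality of representatives.\<close>
definition linear_L1 :: "(real^'d \<Rightarrow> real \<Rightarrow> complex^'m^'m) \<Rightarrow> bool" where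
  "linear_L1 T \<longleftrightarrow> (\<forall>x y (a::real) (b::real).
     AE \<omega> in lebesgue_on {0..1}. T (a *\<^sub>R x + b *\<^sub>R y) \<omega> = a *\<^sub>R T x \<omega> + b *\<^sub>R T y \<omega>)"

end

theory Submission
  imports Defs "HOL-Probability.Probability"
begin

text \<open>
  By the spectral theorem the trace norm of a Hermitian matrix is the maximum of the real inner product
  with the contractions; hence it is a norm, and sums of trace norms of linear matrix pencils are support
  functions of Minkowski sums of linear images of the contraction ball. Hausdorff distance of convex
  bodies is uniform distance of their support functions on the unit sphere.

  Given an embedding \<open>T\<close>, approximating the matrices \<open>T e\<^sub>1, \<dots>, T e\<^sub>d\<close> in \<open>L\<^sup>1\<close> by simple functions
  approximates the body by operatopes. Conversely, an operatope is a finite measure on the compact set of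
  Hermitian matrix tuples of norm at most 1, and the masses stay bounded along a convergent sequence.
  That compact set is a continuous image of a compact subset of the line, via the Cantor set, so the
  measures can be lifted to the line; there Helly's selection theorem gives a weak limit, and the quantile
  function realises it on \<open>[0,1]\<close>.
\<close>

section \<open>The trace norm as the dual of the operator norm\<close>

text \<open>\<open>trace_norm\<close> is read off the characteristic polynomial, which hides
  subadditivity, continuity and measurability. The proof therefore works with
  \<open>nuclear_norm\<close>, a supremum of real-linear functionals that is a norm on all complex
  matrices and agrees with \<open>trace_norm\<close> on Hermitian ones. From operanoids to
  embeddings, the obstacle is to pass to a limit for all directions \<open>u\<close> at once. Each
  operatope becomes one probability measure independent of \<open>u\<close>; directions enter only
  through continuous, positively homogeneous integrands \<open>q u\<close>. Homogeneity permits
  rescaling each tuple to norm at most 1, its length becoming a weight. The total weight is bounded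
  because the Frobenius norm of a Hermitian matrix is at most its trace norm, so the symmetrised
  support functions at the coordinate vectors dominate it. Weak convergence on the line needs
  integrands continuous on all of it; hence the parametrization is extended from its compact domain
  to the line by Dugundji's theorem, with values kept in the ball by convexity.\<close>

definition cinner :: "complex^'m \<Rightarrow> complex^'m \<Rightarrow> complex" where
  "cinner x y = (\<Sum>i\<in>UNIV. cnj (x$i) * y$i)"

definition adj :: "complex^'m^'n \<Rightarrow> complex^'n^'m" where
  "adj A = (\<chi> i j. cnj (A$j$i))"

text \<open>Links complex orthogonality with the real inner product of the library: variational
  arguments use the latter, unitary matrices the former.\<close>

lemma Re_cinner: "Re (cinner x y) = x \<bullet> y"
  by (simp add: cinner_def inner_vec_def inner_complex_def)

lemma cinner_scaleR_left: "cinner (r *\<^sub>R x) y = r *\<^sub>R cinner x y"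
  by (simp add: cinner_def scaleR_sum_right)

lemma cinner_scaleR_right: "cinner x (r *\<^sub>R y) = r *\<^sub>R cinner x y"
  by (simp add: cinner_def scaleR_sum_right)

lemma cinner_diff_right: "cinner x (y - z) = cinner x y - cinner x z"
  by (simp add: cinner_def right_diff_distrib sum_subtractf)

lemma cinner_add_right: "cinner x (y + z) = cinner x y + cinner x z"
  by (simp add: cinner_def distrib_left sum.distrib)

lemma cinner_commute: "cinner y x = cnj (cinner x y)"
  by (simp add: cinner_def mult.commute)

lemma cinner_self: "cinner x x = of_real ((norm x)\<^sup>2)"
proof -
  have "cnj (cinner x x) = cinner x x"
    using cinner_commute[of x x] by simp
  then have "Im (cinner x x) = 0"
    by (simp add: complex_eq_iff)
  then show ?thesis
    by (simp add: complex_eq_iff Re_cinner dot_square_norm)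
qed

lemma continuous_on_cinner: "continuous_on S (cinner x)"
  unfolding cinner_def by (intro continuous_intros)

lemma cinner_adj: "cinner (A *v x) y = cinner x (adj A *v y)"
  unfolding cinner_def adj_def matrix_vector_mult_def
  by (simp add: sum_distrib_left sum_distrib_right mult_ac) (rule sum.swap)

lemma inner_adj: "(A *v x) \<bullet> y = x \<bullet> (adj A *v y)"
  by (simp flip: Re_cinner add: cinner_adj)

lemma hermitian_iff_adj: "hermitian A \<longleftrightarrow> adj A = A"
  unfolding hermitian_def adj_def vec_eq_iff vec_lambda_beta by metis

lemma linear_complex_matrix_vector_mult: "linear ((*v) (A :: complex^'m^'n))"
  by (rule linearI)
    (simp_all add: matrix_vector_mult_def vec_eq_iff scaleR_sum_right distrib_left sum.distrib)

lemma continuous_on_complex_matrix_vector_mult: "continuous_on S ((*v) (A :: complex^'m^'n))"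
  by (rule linear_continuous_on)
    (simp add: linear_complex_matrix_vector_mult linear_conv_bounded_linear [symmetric])

section \<open>Orthonormal eigenbases of Hermitian matrices\<close>

lemma ex_orthogonal_vector:
  fixes u :: "'m::finite \<Rightarrow> complex^'m"
  assumes "k \<notin> I"
  shows "\<exists>x. x \<noteq> 0 \<and> (\<forall>i\<in>I. cinner (u i) x = 0)"
proof -
  \<comment> \<open>Fewer than \<open>CARD('m)\<close> linear conditions have a common nonzero
    solution: the row of the spare index \<open>k\<close> is zero, so \<open>M\<close> is
    singular.\<close>
  define M :: "complex^'m^'m" where "M = (\<chi> i j. if i \<in> I then cnj (u i $ j) else 0)"
  have "row k M = 0"
    using assms by (simp add: M_def row_def vec_eq_iff)
  then have "\<not> invertible M"
    by (simp add: invertible_det_nz det_zero_row)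
  then obtain x where "M *v x = 0" "x \<noteq> 0"
    by (metis invertible_left_inverse matrix_left_invertible_ker)
  moreover have "cinner (u i) x = (M *v x) $ i" if "i \<in> I" for i
    using that by (simp add: M_def cinner_def matrix_vector_mult_def)
  ultimately show ?thesis
    by (metis zero_index)
qed

text \<open>The orthogonal complement \<open>W\<close> of the eigenvectors found so far is invariant
  because \<open>A\<close> is self-adjoint. A maximiser of the quadratic form of \<open>A\<close> on
  the unit sphere of \<open>W\<close> is an eigenvector, with the maximum as eigenvalue, so the
  eigenvalue is real from the start.\<close>

lemma hermitian_eigenvector_orthogonal:
  fixes A :: "complex^'m^'m" and u :: "'m \<Rightarrow> complex^'m"
  assumes A: "hermitian A" and "k \<notin> I"
    and eig: "\<And>i. i \<in> I \<Longrightarrow> A *v u i = d i *\<^sub>R u i"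
  shows "\<exists>x l. norm x = 1 \<and> (\<forall>i\<in>I. cinner (u i) x = 0) \<and> A *v x = l *\<^sub>R x"
proof -
  interpret A: linear "(*v) A"
    by (rule linear_complex_matrix_vector_mult)
  define W where "W = (\<Inter>i\<in>I. {x. cinner (u i) x = 0})"
  have "closed W"
    unfolding W_def
    by (intro closed_INT ballI closed_Collect_eq continuous_on_cinner continuous_on_const)
  then have "compact (sphere 0 1 \<inter> W)"
    by (rule compact_Int_closed[OF compact_sphere])
  have W_add: "x + y \<in> W" and W_diff: "x - y \<in> W" if "x \<in> W" "y \<in> W" for x y
    using that by (simp_all add: W_def cinner_add_right cinner_diff_right)
  have W_scaleR: "r *\<^sub>R x \<in> W" if "x \<in> W" for x r
    using that by (simp add: W_def cinner_scaleR_right)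
  have W_A: "A *v x \<in> W" if "x \<in> W" for x
  proof -
    have "cinner (u i) (A *v x) = 0" if "i \<in> I" for i
      using that \<open>x \<in> W\<close> cinner_adj[of A "u i" x] A eig[OF that]
      by (simp add: hermitian_iff_adj W_def cinner_scaleR_left)
    then show ?thesis by (simp add: W_def)
  qed
  have sa: "(A *v x) \<bullet> y = x \<bullet> (A *v y)" for x y
    using A by (simp add: inner_adj hermitian_iff_adj)
  obtain x0 where "x0 \<noteq> 0" "x0 \<in> W"
    using ex_orthogonal_vector[OF \<open>k \<notin> I\<close>, of u] by (auto simp: W_def)
  then have "(1 / norm x0) *\<^sub>R x0 \<in> sphere 0 1 \<inter> W"
    using W_scaleR by simp
  then have "sphere 0 1 \<inter> W \<noteq> {}"
    by blast
  moreover have "continuous_on (sphere 0 1 \<inter> W) (\<lambda>x. x \<bullet> (A *v x))"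
    by (intro continuous_intros continuous_on_complex_matrix_vector_mult)
  ultimately obtain x where x: "norm x = 1" "x \<in> W"
    and max: "\<And>z. norm z = 1 \<Longrightarrow> z \<in> W \<Longrightarrow> z \<bullet> (A *v z) \<le> x \<bullet> (A *v x)"
    using continuous_attains_sup[OF \<open>compact (sphere 0 1 \<inter> W)\<close>]
    by (metis (no_types, lifting) Int_iff mem_sphere_0)
  define l where "l = x \<bullet> (A *v x)"
  have le: "z \<bullet> (A *v z) \<le> l * (z \<bullet> z)" if "z \<in> W" for z
  proof (cases "z = 0")
    case False
    define w where "w = (1 / norm z) *\<^sub>R z"
    have "norm w = 1" "w \<in> W" and z: "z = norm z *\<^sub>R w"
      using False that W_scaleR by (simp_all add: w_def)
    have "z \<bullet> (A *v z) = (norm z)\<^sup>2 * (w \<bullet> (A *v w))"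
      by (subst (1 2) z) (simp add: A.scaleR power2_eq_square)
    also have "\<dots> \<le> (norm z)\<^sup>2 * l"
      unfolding l_def using max[OF \<open>norm w = 1\<close> \<open>w \<in> W\<close>] by (intro mult_left_mono) auto
    finally show ?thesis by (simp add: dot_square_norm mult.commute)
  qed simp
  \<comment> \<open>first-order optimality of \<open>x\<close> in the direction of the residual \<open>y\<close>\<close>
  define y where "y = l *\<^sub>R x - A *v x"
  have "y \<in> W"
    using x W_A W_scaleR W_diff by (simp add: y_def)
  define c where "c = l * (y \<bullet> y) - y \<bullet> (A *v y)"
  have "c \<ge> 0" using le[OF \<open>y \<in> W\<close>] by (simp add: c_def)
  have "x \<bullet> x = 1"
    using x by (simp add: dot_square_norm)
  \<comment> \<open>This is \<open>le\<close> at the point \<open>x + t *\<^sub>R y\<close>: the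
    constant terms cancel and the linear coefficient is \<open>2 * (y \<bullet> y)\<close>, so a
    small negative \<open>t\<close> contradicts it unless \<open>y = 0\<close>.\<close>
  have quad: "0 \<le> t\<^sup>2 * c + 2 * t * (y \<bullet> y)" for t
  proof -
    have s: "y \<bullet> y = l * (x \<bullet> y) - x \<bullet> (A *v y)"
      using sa[of x y] inner_diff_left[of "l *\<^sub>R x" "A *v x" y] by (simp flip: y_def)
    have "y \<bullet> (A *v x) = x \<bullet> (A *v y)"
      using sa[of x y] by (simp add: inner_commute)
    then have "(x + t *\<^sub>R y) \<bullet> (A *v (x + t *\<^sub>R y))
        = l + 2 * t * (x \<bullet> (A *v y)) + t\<^sup>2 * (y \<bullet> (A *v y))"
      by (simp add: A.add A.scaleR inner_add_left inner_add_right l_def power2_eq_square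
          distrib_left)
    moreover have "(x + t *\<^sub>R y) \<bullet> (x + t *\<^sub>R y) = 1 + 2 * t * (x \<bullet> y) + t\<^sup>2 * (y \<bullet> y)"
      using \<open>x \<bullet> x = 1\<close> inner_commute[of y x]
      by (simp add: inner_add_left inner_add_right power2_eq_square distrib_left)
    moreover have "2 * t * (y \<bullet> y) = 2 * t * (l * (x \<bullet> y) - x \<bullet> (A *v y))"
      using s by simp
    ultimately have "t\<^sup>2 * c + 2 * t * (y \<bullet> y)
        = l * ((x + t *\<^sub>R y) \<bullet> (x + t *\<^sub>R y)) - (x + t *\<^sub>R y) \<bullet> (A *v (x + t *\<^sub>R y))"
      unfolding c_def by (simp only: ring_distribs) (simp add: algebra_simps)
    also have "\<dots> \<ge> 0"
      using le[of "x + t *\<^sub>R y"] x \<open>y \<in> W\<close> W_add W_scaleR by simp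
    finally show ?thesis .
  qed
  have "y \<bullet> y = 0"
  proof (rule ccontr)
    assume "y \<bullet> y \<noteq> 0"
    then have s: "y \<bullet> y > 0" by simp
    \<comment> \<open>The denominator \<open>c + 1\<close> stays positive also for
      \<open>c = 0\<close>; this choice turns the quadratic into
      \<open>- (t\<^sup>2 * (c + 2))\<close>.\<close>
    define t where "t = - (y \<bullet> y) / (c + 1)"
    have t: "t * (c + 1) = - (y \<bullet> y)" "t < 0"
      using \<open>c \<ge> 0\<close> s by (auto simp: t_def divide_neg_pos)
    have "0 \<le> t\<^sup>2 * c + 2 * t * (y \<bullet> y)"
      by (rule quad)
    also have "y \<bullet> y = - (t * (c + 1))"
      using t by simp
    also have "t\<^sup>2 * c + 2 * t * - (t * (c + 1)) = - (t\<^sup>2 * (c + 2))"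
      by (simp add: power2_eq_square algebra_simps)
    also have "\<dots> < 0"
      using \<open>c \<ge> 0\<close> \<open>t < 0\<close> by simp
    finally show False by simp
  qed
  then have "A *v x = l *\<^sub>R x"
    by (simp add: y_def)
  then show ?thesis using x by (auto simp: W_def)
qed

lemma hermitian_orthonormal_eigenbasis:
  fixes A :: "complex^'m^'m"
  assumes A: "hermitian A"
  obtains u :: "'m \<Rightarrow> complex^'m" and d :: "'m \<Rightarrow> real"
  where "\<And>i. A *v u i = d i *\<^sub>R u i"
    and "\<And>i j. cinner (u i) (u j) = (if i = j then 1 else 0)"
proof -
  \<comment> \<open>Induction over index sets: the family \<open>u\<close> is total, but only its
    values on \<open>I\<close> are constrained, so a new index is filled by function update.\<close>
  have "\<exists>u d. (\<forall>i\<in>I. A *v u i = d i *\<^sub>R u i) \<and>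
      (\<forall>i\<in>I. \<forall>j\<in>I. cinner (u i) (u j) = (if i = j then 1 else 0))" for I :: "'m set"
    using finite[of I]
  proof (induction I rule: finite_induct)
    case (insert k I)
    then obtain u d where u: "\<And>i. i \<in> I \<Longrightarrow> A *v u i = d i *\<^sub>R u i"
      "\<And>i j. i \<in> I \<Longrightarrow> j \<in> I \<Longrightarrow> cinner (u i) (u j) = (if i = j then 1 else 0)"
      by metis
    obtain x l where x: "norm x = 1" "\<And>i. i \<in> I \<Longrightarrow> cinner (u i) x = 0" "A *v x = l *\<^sub>R x"
      using hermitian_eigenvector_orthogonal[OF A \<open>k \<notin> I\<close>, of u d] u(1) by metis
    have "cinner x (u i) = 0" if "i \<in> I" for i
      using x(2)[OF that] cinner_commute[of x "u i"] by simp
    then show ?case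
      using u x insert(2)
      by (intro exI[of _ "u(k := x)"] exI[of _ "d(k := l)"]) (auto simp: cinner_self[of x])
  qed auto
  from this[of UNIV] show thesis
    using that by auto
qed

section \<open>Eigenvalues as roots of the characteristic polynomial\<close>

lemma order_prod_linear_factors:
  fixes d :: "'i \<Rightarrow> 'a::field"
  assumes "finite I"
  shows "order z (\<Prod>i\<in>I. [:- d i, 1:]) = card {i\<in>I. d i = z}"
  using assms
proof (induction I rule: finite_induct)
  case (insert k I)
  have nz: "[:- d k, 1:] * (\<Prod>i\<in>I. [:- d i, 1:]) \<noteq> 0"
    by (intro no_zero_divisors) (auto simp: insert(1))
  have "order z [:- d k, 1:] = (if d k = z then 1 else 0)"
  proof (cases "d k = z")
    case True
    then show ?thesis
      using order_power_n_n[of z 1] by simp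
  next
    case False
    then show ?thesis
      by (simp add: order_0I)
  qed
  moreover have "{i\<in>insert k I. d i = z}
      = (if d k = z then insert k {i\<in>I. d i = z} else {i\<in>I. d i = z})"
    by auto
  ultimately show ?case
    using insert order_mult[OF nz, of z] by simp
qed (simp add: order_0I)

lemma poly_det: "poly (det M) z = det (\<chi> i j. poly (M$i$j) z)"
  unfolding det_def by (simp add: poly_sum poly_prod of_int_poly)

text \<open>The eigenvectors form a unitary \<open>U\<close> that diagonalises \<open>A\<close>, so
  the characteristic polynomial splits into the factors given by the \<open>d i\<close>. Summing
  over distinct roots with multiplicity is then summing over \<open>i\<close> grouped by the fibres
  of \<open>d\<close>.\<close>

lemma trace_norm_orthonormal_eigenbasis:
  fixes A :: "complex^'m^'m" and u :: "'m \<Rightarrow> complex^'m"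
  assumes eig: "\<And>i. A *v u i = d i *\<^sub>R u i"
    and on: "\<And>i j. cinner (u i) (u j) = (if i = j then 1 else 0)"
  shows "trace_norm A = (\<Sum>i\<in>UNIV. \<bar>d i\<bar>)"
proof -
  define U :: "complex^'m^'m" where "U = (\<chi> i j. u j $ i)"
  define D :: "complex^'m^'m" where "D = (\<chi> i j. if i = j then of_real (d i) else 0)"
  have VU: "adj U ** U = mat 1"
    using on by (simp add: adj_def U_def matrix_matrix_mult_def mat_def vec_eq_iff cinner_def)
  then have UV: "U ** adj U = mat 1"
    by (simp add: matrix_left_right_inverse)
  have AU: "A ** U = U ** D"
  proof -
    have "(A ** U) $ i $ j = (A *v u j) $ i" for i j
      by (simp add: matrix_matrix_mult_def matrix_vector_mult_def U_def)
    moreover have "(U ** D) $ i $ j = (d j *\<^sub>R u j) $ i" for i j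
      by (simp add: matrix_matrix_mult_def U_def D_def if_distrib[of "(*) _"] scaleR_conv_of_real[where 'a=complex] mult.commute cong: if_cong)
    ultimately show ?thesis by (simp add: vec_eq_iff eig)
  qed
  \<comment> \<open>Equality is proved value by value: \<open>poly_det\<close> moves evaluation
    inside the determinant, so the similarity with \<open>D\<close> takes place among complex
    matrices and not polynomial ones.\<close>
  have "poly (char_poly_cart A) z = poly (\<Prod>i\<in>UNIV. [:- of_real (d i), 1:]) z" for z
  proof -
    have "poly (char_poly_cart A) z = det (mat z - A)"
      unfolding char_poly_cart_def poly_det
      by (rule arg_cong[of _ _ det]) (simp add: vec_eq_iff mat_def)
    also have "mat z - A = U ** (mat z - D) ** adj U"
    proof -
      have "U ** mat z = mat z ** U"
        by (simp add: matrix_matrix_mult_def mat_def vec_eq_iff if_distrib[of "(*) _"] if_distrib[of "\<lambda>x. x * _"] mult.commute cong: if_cong)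
      moreover have "U ** (X - Y) = U ** X - U ** Y" "(X - Y) ** U = X ** U - Y ** U" for X Y
        by (simp_all add: matrix_matrix_mult_def vec_eq_iff left_diff_distrib right_diff_distrib
            sum_subtractf)
      ultimately have "U ** (mat z - D) = (mat z - A) ** U"
        by (simp add: AU)
      then show ?thesis
        by (simp add: matrix_mul_assoc[symmetric] UV)
    qed
    also have "det \<dots> = det (U ** adj U) * det (mat z - D)"
      by (simp add: det_mul)
    also have "\<dots> = (\<Prod>i\<in>UNIV. z - of_real (d i))"
      unfolding UV by (simp add: det_diagonal mat_def D_def)
    finally show ?thesis by (simp add: poly_prod)
  qed
  then have cp: "char_poly_cart A = (\<Prod>i\<in>UNIV. [:- of_real (d i), 1:])"
    by (simp add: poly_eq_poly_eq_iff[symmetric] fun_eq_iff)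
  have roots: "{z. poly (char_poly_cart A) z = 0} = range (\<lambda>i. of_real (d i) :: complex)"
    unfolding cp by (auto simp: poly_prod image_iff)
  have "trace_norm A = (\<Sum>z\<in>range (\<lambda>i. of_real (d i) :: complex).
      \<Sum>i\<in>{i\<in>UNIV. of_real (d i) = z}. cmod (of_real (d i)))"
    unfolding trace_norm_def roots by (simp add: cp order_prod_linear_factors)
  also have "\<dots> = (\<Sum>i\<in>UNIV. cmod (of_real (d i)))"
    by (rule sum.image_gen[symmetric]) simp
  finally show ?thesis by simp
qed

section \<open>The contraction ball and its support function\<close>

definition contractions :: "(complex^'m^'m) set" where
  "contractions = {B. \<forall>x. norm (B *v x) \<le> norm x}"

text \<open>This is the dual of the operator norm, defined for every matrix so that the norm laws
  carry no Hermitian side condition.\<close>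

definition nuclear_norm :: "complex^'m^'m \<Rightarrow> real" where
  "nuclear_norm A = (SUP B\<in>contractions. A \<bullet> B)"

lemma zero_in_contractions: "0 \<in> contractions"
  by (simp add: contractions_def)

lemma uminus_contractions: "B \<in> contractions \<Longrightarrow> - B \<in> contractions"
proof -
  have "(- B) *v x = - (B *v x)" for x
    by (simp add: matrix_vector_mult_def vec_eq_iff sum_negf)
  then show "B \<in> contractions \<Longrightarrow> - B \<in> contractions"
    by (simp add: contractions_def)
qed

lemma linear_matrix_vector_mult_left: "linear (\<lambda>B :: complex^'m^'n. B *v x)"
  by (rule linearI)
    (simp_all add: matrix_vector_mult_def vec_eq_iff scaleR_sum_right distrib_right sum.distrib)

lemma convex_contractions: "convex (contractions :: (complex^'m^'m) set)"
proof -
  have "contractions = (\<Inter>x. (\<lambda>B :: complex^'m^'m. B *v x) -` cball 0 (norm x))"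
    by (auto simp: contractions_def)
  also have "convex \<dots>"
    by (intro convex_INT convex_linear_vimage linear_matrix_vector_mult_left convex_cball)
  finally show ?thesis .
qed

lemma compact_contractions: "compact (contractions :: (complex^'m^'m) set)"
proof -
  have eq: "contractions = (\<Inter>x. (\<lambda>B :: complex^'m^'m. B *v x) -` cball 0 (norm x))"
    by (auto simp: contractions_def)
  have "closed (contractions :: (complex^'m^'m) set)"
    unfolding eq
    by (intro closed_INT ballI closed_vimage linear_continuous_on)
      (simp_all add: linear_matrix_vector_mult_left linear_conv_bounded_linear [symmetric])
  moreover have "bounded (contractions :: (complex^'m^'m) set)"
  proof (rule boundedI)
    fix B :: "complex^'m^'m" assume B: "B \<in> contractions"
    have "norm (B $ i $ j) \<le> 1" for i j
    proof -
      have "B $ i $ j = (B *v axis j 1) $ i"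
        by (simp add: matrix_vector_mult_def axis_def if_distrib[of "(*) _"] cong: if_cong)
      also have "norm \<dots> \<le> norm (B *v axis j 1)"
        by (rule Finite_Cartesian_Product.norm_nth_le)
      also have "\<dots> \<le> norm (axis j (1::complex))"
        using B unfolding contractions_def by blast
      finally show ?thesis by simp
    qed
    moreover have "norm B \<le> (\<Sum>i\<in>UNIV. \<Sum>j\<in>UNIV. norm (B $ i $ j))"
      unfolding norm_vec_def[where 'a="complex^'m"]
      by (rule order_trans[OF L2_set_le_sum]) (auto intro!: sum_mono simp: norm_vec_def L2_set_le_sum)
    ultimately show "norm B \<le> (\<Sum>i\<in>(UNIV::'m set). \<Sum>j\<in>(UNIV::'m set). 1)"
      by (meson order_trans sum_mono)
  qed
  ultimately show ?thesis
    by (simp add: compact_eq_bounded_closed)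
qed

text \<open>The inner product is the real part of the trace of \<open>A ** adj B\<close>. With
  \<open>U\<close> the unitary matrix of columns \<open>u k\<close>, the product
  \<open>U ** adj U = mat 1\<close> can be inserted between the factors.\<close>

lemma inner_orthonormal_basis:
  fixes A B :: "complex^'m^'m" and u :: "'m \<Rightarrow> complex^'m"
  assumes on: "\<And>i j. cinner (u i) (u j) = (if i = j then 1 else 0)"
  shows "A \<bullet> B = (\<Sum>k\<in>UNIV. (A *v u k) \<bullet> (B *v u k))"
proof -
  define U :: "complex^'m^'m" where "U = (\<chi> i j. u j $ i)"
  have "adj U ** U = mat 1"
    using on by (simp add: adj_def U_def matrix_matrix_mult_def mat_def vec_eq_iff cinner_def)
  then have UV: "U ** adj U = mat 1"
    by (simp add: matrix_left_right_inverse)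
  have adj_mult: "adj (B ** U) = adj U ** adj B"
    by (simp add: adj_def matrix_matrix_mult_def vec_eq_iff mult.commute)
  have tr: "Re (trace (X ** adj Y)) = X \<bullet> Y" for X Y :: "complex^'m^'m"
    by (simp add: trace_def matrix_matrix_mult_def adj_def inner_vec_def inner_complex_def)
  have "A \<bullet> B = Re (trace (A ** (U ** adj U) ** adj B))"
    by (simp add: UV tr)
  also have "\<dots> = (A ** U) \<bullet> (B ** U)"
    by (simp add: matrix_mul_assoc adj_mult flip: tr)
  also have "\<dots> = (\<Sum>k\<in>UNIV. \<Sum>i\<in>UNIV. (A *v u k) $ i \<bullet> (B *v u k) $ i)"
    unfolding inner_vec_def
    by (subst sum.swap) (simp add: matrix_matrix_mult_def matrix_vector_mult_def U_def)
  finally show ?thesis by (simp add: inner_vec_def)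
qed

text \<open>In an eigenbasis \<open>A \<bullet> B\<close> is the sum of \<open>d k\<close> times the
  real parts of the diagonal entries of \<open>B\<close>, which have modulus at most 1 for a
  contraction. Equality is reached by the matrix sign of \<open>A\<close>. The last bound compares
  the Euclidean norm of the eigenvalue vector with the sum of absolute values.\<close>

lemma contractions_attain_trace_norm:
  fixes A :: "complex^'m^'m"
  assumes "hermitian A"
  shows "B \<in> contractions \<Longrightarrow> A \<bullet> B \<le> trace_norm A"
    and "\<exists>B\<in>contractions. A \<bullet> B = trace_norm A"
    and "norm A \<le> trace_norm A"
proof -
  obtain u :: "'m \<Rightarrow> complex^'m" and d where eig: "\<And>i. A *v u i = d i *\<^sub>R u i"
    and on: "\<And>i j. cinner (u i) (u j) = (if i = j then 1 else 0)"
    using hermitian_orthonormal_eigenbasis[OF assms] by blast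
  note tn = trace_norm_orthonormal_eigenbasis[OF eig on]
  have inner_u: "u k \<bullet> u k = 1" for k
    using on[of k k] by (simp flip: Re_cinner)
  then have norm_u: "norm (u k) = 1" for k
    by (simp add: norm_eq_1)
  have expand: "A \<bullet> B = (\<Sum>k\<in>UNIV. d k * (u k \<bullet> (B *v u k)))" for B
    by (simp add: inner_orthonormal_basis[OF on, of A B] eig)
  show "A \<bullet> B \<le> trace_norm A" if "B \<in> contractions"
  proof -
    have "d k * (u k \<bullet> (B *v u k)) \<le> \<bar>d k\<bar>" for k
    proof -
      have "\<bar>u k \<bullet> (B *v u k)\<bar> \<le> norm (u k) * norm (B *v u k)"
        by (rule Cauchy_Schwarz_ineq2)
      also have "\<dots> \<le> 1"
      proof -
        have "norm (B *v u k) \<le> norm (u k)"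
          using that unfolding contractions_def by blast
        then show ?thesis by (simp add: norm_u)
      qed
      finally have "\<bar>d k * (u k \<bullet> (B *v u k))\<bar> \<le> \<bar>d k\<bar> * 1"
        unfolding abs_mult by (intro mult_left_mono) auto
      then show ?thesis by simp
    qed
    then show ?thesis
      unfolding expand tn by (intro sum_mono)
  qed
  show "norm A \<le> trace_norm A"
  proof -
    have "(norm A)\<^sup>2 = (\<Sum>k\<in>UNIV. (d k)\<^sup>2)"
      unfolding power2_norm_eq_inner by (simp add: inner_orthonormal_basis[OF on, of A A] eig inner_u power2_eq_square)
    then have "norm A = L2_set d UNIV"
      by (metis L2_set_def norm_ge_zero real_sqrt_unique)
    then show ?thesis
      unfolding tn by (simp add: L2_set_le_sum_abs)
  qed
  show "\<exists>B\<in>contractions. A \<bullet> B = trace_norm A"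
  proof -
    define U :: "complex^'m^'m" where "U = (\<chi> i j. u j $ i)"
    \<comment> \<open>The sign of \<open>A\<close> in its eigenbasis; a vanishing eigenvalue gets
      the entry 0, which a contraction allows.\<close>
    define S :: "complex^'m^'m" where "S = (\<chi> i j. if i = j then of_real (sgn (d i)) else 0)"
    define B where "B = U ** S ** adj U"
    have VU: "adj U ** U = mat 1"
      using on by (simp add: adj_def U_def matrix_matrix_mult_def mat_def vec_eq_iff cinner_def)
    then have UV: "U ** adj U = mat 1"
      by (simp add: matrix_left_right_inverse)
    have adj_adj: "adj (adj U) = U"
      by (simp add: adj_def vec_eq_iff)
    have nU: "norm (U *v x) = norm x" and nV: "norm (adj U *v x) = norm x" for x
      by (simp_all add: norm_eq_sqrt_inner inner_adj adj_adj matrix_vector_mul_assoc UV VU)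
    have nS: "norm (S *v x) \<le> norm x" for x
      unfolding norm_vec_def
    proof (rule L2_set_mono)
      fix i
      have "(S *v x) $ i = of_real (sgn (d i)) * x $ i"
        by (simp add: S_def matrix_vector_mult_def if_distrib[of "\<lambda>x. x * _"] cong: if_cong)
      then show "norm ((S *v x) $ i) \<le> norm (x $ i)"
        by (simp add: norm_mult abs_sgn_eq)
    qed simp
    have B: "B *v x = U *v (S *v (adj U *v x))" for x
      by (simp add: B_def matrix_vector_mul_assoc matrix_mul_assoc)
    have "norm (B *v x) \<le> norm x" for x
      using nS[of "adj U *v x"] by (simp add: B nU nV)
    then have "B \<in> contractions"
      by (simp add: contractions_def)
    moreover have "B *v u k = sgn (d k) *\<^sub>R u k" for k
    proof -
      have "adj U *v u k = axis k 1"
        using on by (simp add: adj_def U_def matrix_vector_mult_def axis_def vec_eq_iff cinner_def)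
      moreover have "S *v axis k 1 = sgn (d k) *\<^sub>R axis k 1"
        by (simp add: S_def matrix_vector_mult_def axis_def vec_eq_iff scaleR_conv_of_real[where 'a=complex] if_distrib[of "(*) _"] cong: if_cong)
      moreover have "U *v axis k 1 = u k"
        by (simp add: U_def matrix_vector_mult_def axis_def vec_eq_iff if_distrib[of "(*) _"] cong: if_cong)
      ultimately show ?thesis
        by (simp add: B linear_scale[OF linear_complex_matrix_vector_mult])
    qed
    then have "A \<bullet> B = trace_norm A"
      unfolding expand tn by (simp add: inner_u abs_sgn)
    ultimately show ?thesis by blast
  qed
qed

lemma bdd_above_contractions: "bdd_above ((\<lambda>B. A \<bullet> B) ` contractions)"
proof -
  have "continuous_on contractions (\<lambda>B. A \<bullet> B)"
    by (intro continuous_intros)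
  from compact_continuous_image[OF this compact_contractions] show ?thesis
    by (intro bounded_imp_bdd_above compact_imp_bounded)
qed

lemma trace_norm_eq_nuclear_norm:
  assumes "hermitian A"
  shows "trace_norm A = nuclear_norm A"
proof -
  obtain B where "B \<in> contractions" "A \<bullet> B = trace_norm A"
    using contractions_attain_trace_norm(2)[OF assms] by blast
  then show ?thesis
    unfolding nuclear_norm_def using contractions_attain_trace_norm(1)[OF assms]
    by (metis (mono_tags, lifting) cSup_eq_maximum imageE imageI)
qed

lemma norm_le_trace_norm: "hermitian A \<Longrightarrow> norm A \<le> trace_norm A"
  by (rule contractions_attain_trace_norm)

lemma nuclear_norm_nonneg: "0 \<le> nuclear_norm A"
  unfolding nuclear_norm_def
  by (rule cSUP_upper2[OF bdd_above_contractions zero_in_contractions]) simp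

lemma nuclear_norm_add: "nuclear_norm (A + B) \<le> nuclear_norm A + nuclear_norm B"
  unfolding nuclear_norm_def inner_add_left
  using zero_in_contractions
  by (intro cSUP_least add_mono cSUP_upper bdd_above_contractions) auto

lemma nuclear_norm_zero [simp]: "nuclear_norm 0 = 0"
proof -
  have "(contractions :: (complex^'a^'a) set) \<noteq> {}"
    using zero_in_contractions by blast
  then show ?thesis by (simp add: nuclear_norm_def)
qed

lemma nuclear_norm_scaleR_nonneg:
  assumes "0 \<le> r"
  shows "nuclear_norm (r *\<^sub>R A) = r * nuclear_norm A"
proof (cases "r = 0")
  case False
  with assms have "0 < r" by simp
  \<comment> \<open>Only one inequality is proved here; applying it to \<open>1 / r\<close> and
    \<open>r *\<^sub>R A\<close> yields the other.\<close>
  have le: "nuclear_norm (s *\<^sub>R C) \<le> s * nuclear_norm C" if "0 < s" for s and C :: "complex^'m^'m"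
    unfolding nuclear_norm_def inner_scaleR_left using that zero_in_contractions
    by (intro cSUP_least mult_left_mono cSUP_upper bdd_above_contractions) auto
  show ?thesis
    using le[OF \<open>0 < r\<close>, of A] le[of "1 / r" "r *\<^sub>R A"] \<open>0 < r\<close>
    by (simp add: field_simps)
qed simp

lemma nuclear_norm_minus: "nuclear_norm (- A) = nuclear_norm A"
proof -
  have le: "nuclear_norm (- C) \<le> nuclear_norm C" for C :: "complex^'m^'m"
    unfolding nuclear_norm_def
  proof (rule cSUP_least)
    fix B :: "complex^'m^'m" assume "B \<in> contractions"
    then show "- C \<bullet> B \<le> (SUP B\<in>contractions. C \<bullet> B)"
      using cSUP_upper[OF uminus_contractions bdd_above_contractions, of B C] by simp
  qed (use zero_in_contractions in auto)
  from le[of A] le[of "- A"] show ?thesis by simp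
qed

lemma nuclear_norm_scaleR: "nuclear_norm (r *\<^sub>R A) = \<bar>r\<bar> * nuclear_norm A"
  using nuclear_norm_scaleR_nonneg[of r A] nuclear_norm_scaleR_nonneg[of "- r" "A"]
    nuclear_norm_minus[of "r *\<^sub>R A"]
  by (cases "0 \<le> r") auto

lemma nuclear_norm_sum: "nuclear_norm (\<Sum>i\<in>I. f i) \<le> (\<Sum>i\<in>I. nuclear_norm (f i))"
proof (induction I rule: infinite_finite_induct)
  case (insert i I)
  then show ?case using nuclear_norm_add[of "f i" "sum f I"] by simp
qed auto

lemma nuclear_norm_diff: "\<bar>nuclear_norm A - nuclear_norm B\<bar> \<le> nuclear_norm (A - B)"
  using nuclear_norm_add[of B "A - B"] nuclear_norm_add[of A "B - A"] nuclear_norm_minus[of "A - B"]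
  by (simp add: abs_le_iff)

lemma nuclear_norm_le_norm:
  obtains c where "0 \<le> c" "\<And>A :: complex^'m^'m. nuclear_norm A \<le> c * norm A"
proof -
  obtain c where c: "\<And>B :: complex^'m^'m. B \<in> contractions \<Longrightarrow> norm B \<le> c"
    using compact_imp_bounded[OF compact_contractions] by (auto simp: bounded_iff)
  have "nuclear_norm A \<le> c * norm A" for A :: "complex^'m^'m"
    unfolding nuclear_norm_def
  proof (rule cSUP_least)
    fix B :: "complex^'m^'m" assume "B \<in> contractions"
    then have "A \<bullet> B \<le> norm A * c"
      using norm_cauchy_schwarz[of A B] mult_left_mono[OF c, of B "norm A"] by force
    then show "A \<bullet> B \<le> c * norm A" by (simp add: mult.commute)
  qed (use zero_in_contractions in auto)
  moreover have "0 \<le> c" using c[OF zero_in_contractions] by simp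
  ultimately show thesis using that by blast
qed

lemma continuous_on_nuclear_norm: "continuous_on S nuclear_norm"
proof -
  obtain c where c: "0 \<le> c" "\<And>A :: complex^'a^'a. nuclear_norm A \<le> c * norm A"
    using nuclear_norm_le_norm by blast
  have "c-lipschitz_on S (nuclear_norm :: complex^'a^'a \<Rightarrow> real)"
    unfolding lipschitz_on_def dist_norm
    using c nuclear_norm_diff by (auto intro: order_trans)
  then show ?thesis by (rule lipschitz_on_continuous_on)
qed

section \<open>Compact convex sets as continuous images of compact sets of reals\<close>

lemma compact_UNIV_bool_sequences: "compact (UNIV :: (nat \<Rightarrow> bool) set)"
proof -
  have "compact_space (product_topology (\<lambda>_::nat. euclidean :: bool topology) UNIV)"
    unfolding compact_space_product_topology by (simp add: compact_space_def finite_imp_compact)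
  then show ?thesis
    by (simp add: euclidean_product_topology compact_space_def)
qed

lemma binary_expansion:
  assumes "0 \<le> x" "x \<le> (1::real)"
  obtains b :: "nat \<Rightarrow> bool" where "(\<lambda>n. of_bool (b n) * (1/2) ^ Suc n) sums x"
proof -
  \<comment> \<open>\<open>r n\<close> is the remainder after \<open>n\<close> digits, magnified by
    \<open>2 ^ n\<close>; the endpoint \<open>x = 1\<close> reproduces itself and has all digits
    1.\<close>
  define r where "r = rec_nat x (\<lambda>_ y. if y \<ge> 1/2 then 2 * y - 1 else 2 * y)"
  define b where "b n \<longleftrightarrow> r n \<ge> 1/2" for n
  have r0: "r 0 = x" and rS: "r (Suc n) = 2 * r n - of_bool (b n)" for n
    by (simp_all add: r_def b_def)
  have r_bounds: "0 \<le> r n \<and> r n \<le> 1" for n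
  proof (induction n)
    case (Suc n)
    then show ?case by (auto simp: rS b_def)
  qed (use assms r0 in auto)
  have partial: "(\<Sum>k<n. of_bool (b k) * (1/2) ^ Suc k) = x - r n * (1/2) ^ n" for n
    by (induction n) (simp_all add: r0 rS field_simps)
  have "(\<lambda>n. r n * (1/2) ^ n) \<longlonglongrightarrow> 0"
  proof (rule Lim_null_comparison)
    show "\<forall>\<^sub>F n in sequentially. norm (r n * (1/2) ^ n) \<le> (1/2) ^ n"
      using r_bounds by (intro always_eventually) (auto simp: abs_mult)
  qed (simp add: LIMSEQ_power_zero)
  then have "(\<lambda>n. x - r n * (1/2) ^ n) \<longlonglongrightarrow> x - 0"
    by (intro tendsto_intros)
  then have "(\<lambda>n. of_bool (b n) * (1/2) ^ Suc n) sums x"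
    unfolding sums_def partial by simp
  then show thesis by (rule that)
qed

lemma summable_bool_digits:
  assumes "0 \<le> c" "c < (1::real)"
  shows "summable (\<lambda>n. of_bool (P n) * c ^ n)"
  by (rule summable_comparison_test'[where g = "\<lambda>n. c ^ n" and N = 0])
    (use assms in \<open>auto simp: summable_geometric\<close>)

text \<open>Partial sums depend on finitely many coordinates and converge uniformly by the geometric
  majorant. The selector \<open>g\<close> allows one real number to be read from chosen positions of
  the sequence.\<close>

lemma continuous_on_bool_digits:
  fixes g :: "nat \<Rightarrow> nat"
  assumes "0 \<le> c" "c < (1::real)"
  shows "continuous_on UNIV (\<lambda>b :: nat \<Rightarrow> bool. \<Sum>n. of_bool (b (g n)) * c ^ n)"
proof (rule uniform_limit_theorem)
  show "uniform_limit UNIV (\<lambda>n b. \<Sum>k<n. of_bool (b (g k)) * c ^ k)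
      (\<lambda>b. \<Sum>n. of_bool (b (g n)) * c ^ n) sequentially"
    by (rule Weierstrass_m_test[where M = "\<lambda>n. c ^ n"])
      (use assms in \<open>auto simp: summable_geometric\<close>)
  have "continuous_on UNIV (\<lambda>b :: nat \<Rightarrow> bool. of_bool (b k) :: real)" for k
  proof (rule continuous_on_compose2[where f = "\<lambda>b. b k" and g = of_bool and t = UNIV])
    show "continuous_on UNIV (of_bool :: bool \<Rightarrow> real)"
      by (simp add: continuous_on_open_vimage open_discrete)
  qed (auto intro: continuous_on_product_coordinates)
  then show "\<forall>\<^sub>F n in sequentially.
      continuous_on UNIV (\<lambda>b :: nat \<Rightarrow> bool. \<Sum>k<n. of_bool (b (g k)) * c ^ k)"
    by (intro always_eventually allI continuous_intros)
qed simp

text \<open>Base 3 with digits 0 and 1 embeds the Cantor space into the line: the digits after the first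
  difference cannot compensate for it.\<close>

lemma inj_ternary_digits: "inj (\<lambda>b :: nat \<Rightarrow> bool. \<Sum>n. of_bool (b n) * (1/3::real) ^ n)"
proof -
  define e :: "(nat \<Rightarrow> bool) \<Rightarrow> real" where "e b = (\<Sum>n. of_bool (b n) * (1/3) ^ n)" for b
  note sm = summable_bool_digits[of "1/3::real", simplified]
  have less: "e b' < e b" if n: "b n" "\<not> b' n" and eq: "\<And>k. k < n \<Longrightarrow> b k = b' k" for b b' n
  proof -
    have split: "e b = (\<Sum>k<n. of_bool (b k) * (1/3) ^ k) + of_bool (b n) * (1/3) ^ n
        + (\<Sum>k. of_bool (b (k + Suc n)) * (1/3) ^ (k + Suc n))" for b
      unfolding e_def using suminf_split_initial_segment[OF sm, of b "Suc n"] by simp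
    have "(\<lambda>k. (1/3::real) ^ (k + Suc n)) sums (1 / (1 - 1/3) * (1/3) ^ Suc n)"
      unfolding power_add by (intro sums_mult2 geometric_sums) simp
    then have g: "(\<lambda>k. (1/3::real) ^ (k + Suc n)) sums ((1/3) ^ n / 2)"
      by simp
    have "(\<Sum>k. of_bool (b' (k + Suc n)) * (1/3) ^ (k + Suc n)) \<le> (\<Sum>k. (1/3::real) ^ (k + Suc n))"
      by (intro suminf_le summable_ignore_initial_segment sm sums_summable[OF g]) simp
    also have "\<dots> = (1/3) ^ n / 2"
      using g by (simp add: sums_iff)
    also have "\<dots> < (1/3) ^ n" by simp
    finally have tail: "(\<Sum>k. of_bool (b' (k + Suc n)) * (1/3) ^ (k + Suc n)) < (1/3::real) ^ n" .
    have "0 \<le> (\<Sum>k. of_bool (b (k + Suc n)) * (1/3::real) ^ (k + Suc n))"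
      by (intro suminf_nonneg summable_ignore_initial_segment sm) simp
    moreover have "(\<Sum>k<n. of_bool (b k) * (1/3::real) ^ k) = (\<Sum>k<n. of_bool (b' k) * (1/3) ^ k)"
      using eq by (intro sum.cong) auto
    ultimately show ?thesis
      using tail n by (simp add: split)
  qed
  have "e b \<noteq> e b'" if "b \<noteq> b'" for b b'
  proof -
    define n where "n = (LEAST n. b n \<noteq> b' n)"
    have "\<exists>n. b n \<noteq> b' n"
      using that by (simp add: fun_eq_iff)
    then have n: "b n \<noteq> b' n"
      unfolding n_def by (rule LeastI_ex)
    have least: "b k = b' k" if "k < n" for k
      using not_less_Least[OF that[unfolded n_def]] by (rule notnotD)
    show ?thesis
    proof (cases "b n")
      case True
      then have "\<not> b' n" using n by simp
      from less[of b n b', OF True this least] show ?thesis by simp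
    next
      case False
      then have "b' n" using n by simp
      from less[of b' n b, OF this False least[symmetric]] show ?thesis by simp
    qed
  qed
  then show ?thesis
    unfolding inj_def e_def by blast
qed

text \<open>A digit map \<open>X\<close> sends the Cantor space continuously onto a cube around
  \<open>S\<close>, and \<open>e\<close> embeds the Cantor space in the line. On the image under
  \<open>e\<close> of the preimage \<open>K\<close> of \<open>S\<close>, the map \<open>X\<close>
  after the inverse of \<open>e\<close> covers \<open>S\<close>; convexity lets Dugundji's theorem
  extend it to the whole line without leaving \<open>S\<close>.\<close>

lemma compact_convex_real_parametrization:
  fixes S :: "'a::euclidean_space set"
  assumes S: "compact S" "convex S" "S \<noteq> {}"
  obtains \<phi> :: "real \<Rightarrow> 'a" and C where "continuous_on UNIV \<phi>" "range \<phi> \<subseteq> S" "compact C" "\<phi> ` C = S"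
proof -
  obtain M where M: "M > 0" "\<And>x. x \<in> S \<Longrightarrow> norm x \<le> M"
    using compact_imp_bounded[OF S(1)] bounded_pos by blast
  obtain \<iota> :: "'a \<Rightarrow> nat" where \<iota>: "inj_on \<iota> Basis"
    using finite_imp_inj_to_nat_seg[OF finite_Basis] by blast
  \<comment> \<open>The digits of all coordinates share one sequence by way of
    \<open>prod_encode\<close>. The weights start at 1, so the final halving brings the value into
    the unit interval, which \<open>X\<close> rescales to the interval from \<open>- M\<close> to
    \<open>M\<close>.\<close>
  define \<beta> :: "'a \<Rightarrow> (nat \<Rightarrow> bool) \<Rightarrow> real"
    where "\<beta> i b = (\<Sum>n. of_bool (b (prod_encode (\<iota> i, n))) * (1/2) ^ n) / 2" for i b
  define X where "X b = (\<Sum>i\<in>Basis. (M * (2 * \<beta> i b - 1)) *\<^sub>R i)" for b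
  define e :: "(nat \<Rightarrow> bool) \<Rightarrow> real" where "e b = (\<Sum>n. of_bool (b n) * (1/3) ^ n)" for b
  have cont_X: "continuous_on UNIV X"
    unfolding X_def \<beta>_def by (intro continuous_intros continuous_on_bool_digits) auto
  have cont_e: "continuous_on UNIV e"
    unfolding e_def by (rule continuous_on_bool_digits) auto
  have "inj e"
    using inj_ternary_digits unfolding e_def .
  have X_surj: "\<exists>b. X b = x" if "x \<in> S" for x
  proof -
    have "\<exists>b. \<forall>i\<in>Basis. (\<lambda>n. of_bool (b i n) * (1/2) ^ Suc n) sums ((x \<bullet> i / M + 1) / 2)"
    proof (rule bchoice, rule ballI)
      fix i :: 'a assume "i \<in> Basis"
      then have "\<bar>x \<bullet> i\<bar> \<le> M"
        using Basis_le_norm[of i x] M(2)[OF that] by linarith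
      then have "0 \<le> (x \<bullet> i / M + 1) / 2" "(x \<bullet> i / M + 1) / 2 \<le> 1"
        using M(1) by (auto simp: field_simps)
      then show "\<exists>b. (\<lambda>n. of_bool (b n) * (1/2) ^ Suc n) sums ((x \<bullet> i / M + 1) / 2)"
        using binary_expansion by metis
    qed
    then obtain b where b:
      "\<And>i. i \<in> Basis \<Longrightarrow> (\<lambda>n. of_bool (b i n) * (1/2) ^ Suc n) sums ((x \<bullet> i / M + 1) / 2)"
      by blast
    \<comment> \<open>Interleaves the digit sequences of the coordinates: position \<open>m\<close>
      decodes to a coordinate and a digit index.\<close>
    define b' where "b' m = b (inv_into Basis \<iota> (fst (prod_decode m))) (snd (prod_decode m))" for m
    have "\<beta> i b' = (x \<bullet> i / M + 1) / 2" if "i \<in> Basis" for i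
    proof -
      have "(\<lambda>n. of_bool (b i n) * (1/2) ^ n * (1/2)) sums ((x \<bullet> i / M + 1) / 2)"
        using b[OF that] by (simp add: mult_ac)
      then have "(\<lambda>n. of_bool (b i n) * (1/2) ^ n) sums (x \<bullet> i / M + 1)"
        using sums_mult2_iff[of "1/2" _ "x \<bullet> i / M + 1"] by simp
      then show ?thesis
        using that \<iota> by (simp add: \<beta>_def b'_def sums_iff)
    qed
    then have "X b' = (\<Sum>i\<in>Basis. (x \<bullet> i) *\<^sub>R i)"
      unfolding X_def using M(1) by (intro sum.cong) (auto simp: field_simps)
    then show ?thesis
      by (metis euclidean_representation)
  qed
  define K where "K = X -` S"
  have "closed K"
    unfolding K_def using cont_X S(1) by (intro closed_vimage compact_imp_closed)
  then have "compact K"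
    using compact_Int_closed[OF compact_UNIV_bool_sequences] by simp
  have XK: "X ` K = S"
    using X_surj by (force simp: K_def)
  define \<phi>0 where "\<phi>0 t = X (inv e t)" for t
  have \<phi>0e: "\<phi>0 (e b) = X b" for b
    using \<open>inj e\<close> by (simp add: \<phi>0_def)
  have "compact (e ` K)"
    using \<open>compact K\<close> cont_e by (metis compact_continuous_image continuous_on_subset subset_UNIV)
  have "continuous_on (e ` K) (inv e)"
    using \<open>compact K\<close> cont_e \<open>inj e\<close>
    by (intro continuous_on_inv) (auto intro: continuous_on_subset)
  then have "continuous_on (e ` K) \<phi>0"
    unfolding \<phi>0_def by (rule continuous_on_compose2[OF cont_X]) auto
  moreover have \<phi>0_image: "\<phi>0 ` e ` K = S"
    unfolding image_image \<phi>0e by (rule XK)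
  moreover have "closedin (top_of_set UNIV) (e ` K)"
    using \<open>compact (e ` K)\<close> compact_imp_closed by auto
  ultimately obtain \<phi> where "continuous_on UNIV \<phi>" "range \<phi> \<subseteq> S" "\<And>t. t \<in> e ` K \<Longrightarrow> \<phi> t = \<phi>0 t"
    using Dugundji[OF S(2,3), of UNIV "e ` K" \<phi>0] by (metis order_refl)
  moreover from this have "\<phi> ` e ` K = S"
    using \<phi>0_image by (metis image_cong)
  ultimately show thesis
    using \<open>compact (e ` K)\<close> that by blast
qed

section \<open>Support functions and the Hausdorff distance\<close>

lemma convex_body_nonempty: "convex_body K \<Longrightarrow> K \<noteq> {}"
  by (simp add: convex_body_def)

lemma bdd_above_inner_convex_body: "convex_body K \<Longrightarrow> bdd_above ((\<lambda>x. x \<bullet> u) ` K)"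
  unfolding convex_body_def
  by (intro bounded_imp_bdd_above compact_imp_bounded compact_continuous_image) (auto intro: continuous_intros)

lemma support_fun_upper: "convex_body K \<Longrightarrow> x \<in> K \<Longrightarrow> x \<bullet> u \<le> support_fun K u"
  unfolding support_fun_def by (rule cSUP_upper[OF _ bdd_above_inner_convex_body])

lemma support_fun_least:
  assumes "convex_body K" "\<And>x. x \<in> K \<Longrightarrow> x \<bullet> u \<le> c"
  shows "support_fun K u \<le> c"
  unfolding support_fun_def using assms convex_body_nonempty by (intro cSUP_least) auto

lemma support_fun_sums:
  assumes K: "convex_body K" and L: "convex_body L"
  shows "convex_body {x + y | x y. x \<in> K \<and> y \<in> L}" (is "convex_body ?S")
    and "support_fun {x + y | x y. x \<in> K \<and> y \<in> L} u = support_fun K u + support_fun L u"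
proof -
  have "convex ?S"
  proof -
    have "?S = (\<Union>x\<in>K. \<Union>y\<in>L. {x + y})" by auto
    then show ?thesis
      using K L by (simp add: convex_body_def convex_sums)
  qed
  then show S: "convex_body ?S"
    using K L by (auto simp: convex_body_def compact_sums)
  have "support_fun K u \<le> support_fun ?S u - support_fun L u"
  proof (rule support_fun_least[OF K])
    fix x assume "x \<in> K"
    have "support_fun L u \<le> support_fun ?S u - x \<bullet> u"
    proof (rule support_fun_least[OF L])
      fix y assume "y \<in> L"
      then have "(x + y) \<bullet> u \<le> support_fun ?S u"
        using \<open>x \<in> K\<close> by (intro support_fun_upper[OF S]) auto
      then show "y \<bullet> u \<le> support_fun ?S u - x \<bullet> u"
        by (simp add: inner_add_left)
    qed
    then show "x \<bullet> u \<le> support_fun ?S u - support_fun L u" by simp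
  qed
  moreover have "support_fun ?S u \<le> support_fun K u + support_fun L u"
    using support_fun_upper[OF K] support_fun_upper[OF L]
    by (intro support_fun_least[OF S]) (auto simp: inner_add_left intro!: add_mono)
  ultimately show "support_fun ?S u = support_fun K u + support_fun L u" by simp
qed

section \<open>Hausdorff distance in terms of support functions\<close>

lemma bdd_above_infdist: "convex_body K \<Longrightarrow> bdd_above ((\<lambda>a. infdist a L) ` K)"
  unfolding convex_body_def
  by (intro bounded_imp_bdd_above compact_imp_bounded compact_continuous_image)
    (auto intro: continuous_intros)

lemma infdist_le_hausdorff_dist:
  assumes "convex_body K" "a \<in> K"
  shows "infdist a L \<le> hausdorff_dist K L"
  unfolding hausdorff_dist_def
  using cSUP_upper[OF assms(2) bdd_above_infdist[OF assms(1)], of L] by simp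

lemma hausdorff_dist_commute: "hausdorff_dist K L = hausdorff_dist L K"
  by (simp add: hausdorff_dist_def max.commute)

lemma hausdorff_dist_nonneg:
  assumes "convex_body K"
  shows "0 \<le> hausdorff_dist K L"
proof -
  obtain a where "a \<in> K" using convex_body_nonempty[OF assms] by blast
  then show ?thesis
    using infdist_le_hausdorff_dist[OF assms] infdist_nonneg order_trans by blast
qed

text \<open>Replacing \<open>x\<close> by its nearest point \<open>p\<close> in the other body
  changes \<open>x \<bullet> u\<close> by at most the distance times \<open>norm u\<close>.\<close>

lemma support_fun_diff_le_hausdorff_dist:
  assumes K: "convex_body K" and L: "convex_body L"
  shows "\<bar>support_fun K u - support_fun L u\<bar> \<le> hausdorff_dist K L * norm u"
proof -
  have "support_fun K u \<le> support_fun L u + hausdorff_dist K L * norm u"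
    if K: "convex_body K" and L: "convex_body L" for K L
  proof (rule support_fun_least[OF K])
    fix x assume "x \<in> K"
    have "closed L" "L \<noteq> {}"
      using L by (auto simp: convex_body_def compact_imp_closed)
    then obtain p where p: "p \<in> L" "infdist x L = dist x p"
      using infdist_attains_inf by blast
    have "(x - p) \<bullet> u \<le> norm (x - p) * norm u"
      by (rule norm_cauchy_schwarz)
    also have "\<dots> \<le> hausdorff_dist K L * norm u"
      using infdist_le_hausdorff_dist[OF K \<open>x \<in> K\<close>, of L] p by (intro mult_right_mono) (auto simp: dist_norm)
    finally show "x \<bullet> u \<le> support_fun L u + hausdorff_dist K L * norm u"
      using support_fun_upper[OF L p(1), of u] by (simp add: inner_diff_left)
  qed
  from this[OF K L] this[OF L K] show ?thesis
    by (simp add: hausdorff_dist_commute abs_le_iff)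
qed

text \<open>It suffices to test the direction \<open>u = a - p\<close> from the nearest point
  \<open>p\<close> of \<open>L\<close>: there \<open>p\<close> maximises the inner product over
  \<open>L\<close>, so the hypothesis bounds the square of \<open>norm u\<close> by
  \<open>\<epsilon> * norm u\<close>.\<close>

lemma infdist_le_support_fun_diff:
  assumes K: "convex_body K" and L: "convex_body L"
    and le: "\<And>u. support_fun K u \<le> support_fun L u + \<epsilon> * norm u" and "a \<in> K" and "0 \<le> \<epsilon>"
  shows "infdist a L \<le> \<epsilon>"
proof -
  have cl: "closed L" "convex L" "L \<noteq> {}"
    using L by (auto simp: convex_body_def compact_imp_closed)
  define p where "p = closest_point L a"
  define u where "u = a - p"
  have "p \<in> L"
    unfolding p_def by (rule closest_point_in_set[OF cl(1,3)])
  have "support_fun L u \<le> p \<bullet> u"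
  proof (rule support_fun_least[OF L])
    fix y assume "y \<in> L"
    then have "(a - p) \<bullet> (y - p) \<le> 0"
      unfolding p_def by (rule closest_point_dot[OF cl(2,1)])
    then show "y \<bullet> u \<le> p \<bullet> u"
      by (simp add: u_def inner_diff_right inner_commute)
  qed
  then have "a \<bullet> u \<le> p \<bullet> u + \<epsilon> * norm u"
    using support_fun_upper[OF K \<open>a \<in> K\<close>, of u] le[of u] by linarith
  moreover have "a \<bullet> u - p \<bullet> u = norm u * norm u"
    by (simp add: u_def dot_square_norm power2_eq_square flip: inner_diff_left)
  ultimately have "norm u * norm u \<le> \<epsilon> * norm u" by simp
  then have "norm u \<le> \<epsilon>"
    using \<open>0 \<le> \<epsilon>\<close> by (cases "norm u = 0") (simp_all add: mult_le_cancel_right)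
  then show ?thesis
    using infdist_le[OF \<open>p \<in> L\<close>, of a] by (simp add: u_def dist_norm)
qed

lemma hausdorff_dist_le_support_fun_diff:
  assumes K: "convex_body K" and L: "convex_body L" and "0 \<le> \<epsilon>"
    and le: "\<And>u. \<bar>support_fun K u - support_fun L u\<bar> \<le> \<epsilon> * norm u"
  shows "hausdorff_dist K L \<le> \<epsilon>"
proof -
  have "support_fun K u \<le> support_fun L u + \<epsilon> * norm u"
    "support_fun L u \<le> support_fun K u + \<epsilon> * norm u" for u
    using le[of u] by (simp_all add: abs_le_iff)
  then show ?thesis
    unfolding hausdorff_dist_def
    using assms infdist_le_support_fun_diff[OF K L] infdist_le_support_fun_diff[OF L K]
    by (intro max.boundedI cSUP_least convex_body_nonempty) auto
qed

text \<open>The map from \<open>B\<close> to the vector of the \<open>A i \<bullet> B\<close> is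
  adjoint to the pencil sending \<open>u\<close> to the combination of the \<open>A i\<close>;
  pairing the image of the contraction ball with \<open>u\<close> is therefore pairing the ball with
  the pencil.\<close>

lemma contractions_image_body:
  fixes A :: "'d::finite \<Rightarrow> complex^'m^'m"
  defines "L \<equiv> (\<lambda>B. \<chi> i. A i \<bullet> B) ` contractions"
  shows "convex_body L" and "x \<in> L \<Longrightarrow> - x \<in> L"
    and "support_fun L u = nuclear_norm (\<Sum>i\<in>UNIV. u$i *\<^sub>R A i)"
proof -
  have lin: "linear (\<lambda>B. \<chi> i. A i \<bullet> B)"
    by (rule linearI) (simp_all add: vec_eq_iff inner_add_right)
  then have "compact L"
    unfolding L_def
    by (intro compact_continuous_image compact_contractions linear_continuous_on)
      (simp add: linear_conv_bounded_linear[symmetric])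
  moreover have "convex L"
    unfolding L_def by (intro convex_linear_image lin convex_contractions)
  ultimately show "convex_body L"
    using zero_in_contractions by (auto simp: convex_body_def L_def)
  show "- x \<in> L" if x: "x \<in> L"
  proof -
    obtain B where "B \<in> contractions" "x = (\<chi> i. A i \<bullet> B)"
      using x by (auto simp: L_def)
    then have "- B \<in> contractions" "- x = (\<chi> i. A i \<bullet> (- B))"
      using uminus_contractions by (auto simp: vec_eq_iff)
    then show ?thesis unfolding L_def by blast
  qed
  have "(\<chi> i. A i \<bullet> B) \<bullet> u = (\<Sum>i\<in>UNIV. u$i *\<^sub>R A i) \<bullet> B" for B
    by (simp add: inner_vec_def[where 'a=real] inner_sum_left mult.commute)
  then show "support_fun L u = nuclear_norm (\<Sum>i\<in>UNIV. u$i *\<^sub>R A i)"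
    by (simp add: support_fun_def L_def nuclear_norm_def image_image)
qed

lemma nuclear_norm_sum_body:
  fixes A :: "nat \<Rightarrow> 'd::finite \<Rightarrow> complex^'m^'m"
  obtains Z where "convex_body Z" "\<And>x. x \<in> Z \<Longrightarrow> - x \<in> Z"
    and "\<And>u. support_fun Z u = (\<Sum>j<N. nuclear_norm (\<Sum>i\<in>UNIV. u$i *\<^sub>R A j i))"
proof -
  have "\<exists>Z. convex_body Z \<and> (\<forall>x\<in>Z. - x \<in> Z) \<and>
      (\<forall>u. support_fun Z u = (\<Sum>j<N. nuclear_norm (\<Sum>i\<in>UNIV. u$i *\<^sub>R A j i)))"
  proof (induction N)
    case 0
    show ?case
      by (intro exI[of _ "{0}"]) (auto simp: convex_body_def support_fun_def)
  next
    case (Suc N)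
    then obtain Z where Z: "convex_body Z" "\<And>x. x \<in> Z \<Longrightarrow> - x \<in> Z"
      "\<And>u. support_fun Z u = (\<Sum>j<N. nuclear_norm (\<Sum>i\<in>UNIV. u$i *\<^sub>R A j i))"
      by blast
    define L where "L = (\<lambda>B. \<chi> i. A N i \<bullet> B) ` contractions"
    note L = contractions_image_body[where A = "A N", folded L_def]
    have "- z \<in> {x + y | x y. x \<in> Z \<and> y \<in> L}" if z: "z \<in> {x + y | x y. x \<in> Z \<and> y \<in> L}" for z
    proof -
      obtain x y where "z = x + y" "x \<in> Z" "y \<in> L"
        using z by blast
      then have "- z = (- x) + (- y)" "- x \<in> Z" "- y \<in> L"
        using Z(2) L(2) by auto
      then show ?thesis by blast
    qed
    then show ?case
      using support_fun_sums[OF Z(1) L(1)] Z(3) L(3)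
      by (intro exI[of _ "{x + y | x y. x \<in> Z \<and> y \<in> L}"]) simp
  qed
  then show thesis using that by blast
qed

lemma hermitian_sum_scaleR:
  assumes "\<And>i. i \<in> I \<Longrightarrow> hermitian (A i)"
  shows "hermitian (\<Sum>i\<in>I. (c i :: real) *\<^sub>R A i)"
proof -
  have "(\<Sum>x\<in>I. c x *\<^sub>R A x $ i $ j) = (\<Sum>x\<in>I. c x *\<^sub>R cnj (A x $ j $ i))" for i j
    using assms unfolding hermitian_def by (intro sum.cong refl) metis
  then show ?thesis
    by (simp add: hermitian_def)
qed

lemma operatope_nuclear_norm_body:
  fixes A :: "nat \<Rightarrow> 'd::finite \<Rightarrow> complex^'m^'m"
  assumes "\<And>j i. j < N \<Longrightarrow> hermitian (A j i)"
  obtains Z where "operatope TYPE('m) Z"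
    and "\<And>u. support_fun Z u = (\<Sum>j<N. nuclear_norm (\<Sum>i\<in>UNIV. u$i *\<^sub>R A j i))"
proof -
  obtain Z where Z: "convex_body Z" "\<And>x. x \<in> Z \<Longrightarrow> - x \<in> Z"
    "\<And>u. support_fun Z u = (\<Sum>j<N. nuclear_norm (\<Sum>i\<in>UNIV. u$i *\<^sub>R A j i))"
    using nuclear_norm_sum_body by blast
  \<comment> \<open>one vanishing summand is added because an operatope has at least one\<close>
  define A' where "A' j i = (if j < N then A j i else 0)" for j i
  have A': "hermitian (A' j i)" for j i
    using assms by (simp add: A'_def) (simp add: hermitian_def)
  have "support_fun Z u = 0 \<bullet> u + (\<Sum>j<Suc N. trace_norm (\<Sum>i\<in>UNIV. u$i *\<^sub>R A' j i))" for u
    by (simp add: Z(3) trace_norm_eq_nuclear_norm hermitian_sum_scaleR A') (simp add: A'_def)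
  moreover have "x \<in> Z \<longleftrightarrow> - x \<in> Z" for x
    using Z(2)[of x] Z(2)[of "- x"] by auto
  then have "centrally_symmetric Z"
    unfolding centrally_symmetric_def by (intro exI[of _ 0]) simp
  ultimately have "operatope TYPE('m) Z"
    unfolding operatope_def using Z(1) A'
    by (intro conjI exI[of _ "Suc N"] exI[of _ 0] exI[of _ A']) auto
  then show thesis using Z(3) that by blast
qed

section \<open>From embeddings to operatopes\<close>

lemma norm_adj: "norm (adj X) = norm (X :: complex^'m^'m)"
proof -
  have "adj X \<bullet> adj X = X \<bullet> X"
    by (simp add: adj_def inner_vec_def inner_complex_def) (rule sum.swap)
  then show ?thesis by (simp add: norm_eq_sqrt_inner)
qed

lemma linear_adj: "linear (adj :: complex^'m^'m \<Rightarrow> _)"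
  by (rule linearI) (simp_all add: adj_def vec_eq_iff)

text \<open>Simple functions approximating a Hermitian-valued function may take other values; this
  real-linear projection, which does not increase the norm, makes them Hermitian and fixes values
  that already are.\<close>

definition herm_part :: "complex^'m^'m \<Rightarrow> complex^'m^'m" where
  "herm_part X = (1/2) *\<^sub>R (X + adj X)"

lemma hermitian_herm_part: "hermitian (herm_part X)"
  unfolding herm_part_def hermitian_iff_adj
  by (simp add: linear_scale[OF linear_adj] linear_add[OF linear_adj])
    (simp add: adj_def vec_eq_iff add.commute)

lemma herm_part_hermitian: "hermitian X \<Longrightarrow> herm_part X = X"
  by (simp add: herm_part_def hermitian_iff_adj flip: scaleR_2)

lemma linear_herm_part: "linear herm_part"
  unfolding herm_part_def[abs_def]
  by (intro linear_compose_scale_right linear_compose_add linear_adj) (simp add: linear_id[unfolded id_def])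

lemma norm_herm_part: "norm (herm_part X) \<le> norm X"
  using norm_triangle_ineq[of X "adj X"] by (simp add: herm_part_def norm_adj)

text \<open>One constant serves all \<open>u\<close>, so closeness of matrix tuples in L^1 bounds
  the difference of support functions uniformly on the unit sphere. The factor
  \<open>CARD('d)\<close> comes from bounding the coordinates one by one.\<close>

lemma nuclear_norm_combination_lipschitz:
  obtains c where "0 \<le> c"
    "\<And>(u :: real^'d) (a :: (complex^'m^'m)^'d) b.
      \<bar>nuclear_norm (\<Sum>i\<in>UNIV. u$i *\<^sub>R herm_part (a$i)) - nuclear_norm (\<Sum>i\<in>UNIV. u$i *\<^sub>R herm_part (b$i))\<bar>
        \<le> c * norm u * norm (a - b)"
proof -
  obtain c where c: "0 \<le> c" "\<And>A :: complex^'m^'m. nuclear_norm A \<le> c * norm A"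
    using nuclear_norm_le_norm by blast
  define c' where "c' = c * real CARD('d)"
  have "\<bar>nuclear_norm (\<Sum>i\<in>UNIV. u$i *\<^sub>R herm_part (a$i)) - nuclear_norm (\<Sum>i\<in>UNIV. u$i *\<^sub>R herm_part (b$i))\<bar>
      \<le> c' * norm u * norm (a - b)" for u :: "real^'d" and a b :: "(complex^'m^'m)^'d"
  proof -
    have "\<bar>nuclear_norm (\<Sum>i\<in>UNIV. u$i *\<^sub>R herm_part (a$i)) - nuclear_norm (\<Sum>i\<in>UNIV. u$i *\<^sub>R herm_part (b$i))\<bar>
        \<le> nuclear_norm ((\<Sum>i\<in>UNIV. u$i *\<^sub>R herm_part (a$i)) - (\<Sum>i\<in>UNIV. u$i *\<^sub>R herm_part (b$i)))"
      by (rule nuclear_norm_diff)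
    also have "\<dots> = nuclear_norm (\<Sum>i\<in>UNIV. u$i *\<^sub>R herm_part ((a - b)$i))"
      by (simp add: linear_diff[OF linear_herm_part] scaleR_diff_right sum_subtractf)
    also have "\<dots> \<le> (\<Sum>i\<in>UNIV. nuclear_norm (u$i *\<^sub>R herm_part ((a - b)$i)))"
      by (rule nuclear_norm_sum)
    also have "\<dots> \<le> (\<Sum>i\<in>(UNIV::'d set). norm u * (c * norm (a - b)))"
    proof (rule sum_mono)
      fix i
      have "nuclear_norm (herm_part ((a - b)$i)) \<le> c * norm (herm_part ((a - b)$i))"
        by (rule c(2))
      also have "\<dots> \<le> c * norm (a - b)"
        using c(1) norm_herm_part[of "(a - b)$i"] Finite_Cartesian_Product.norm_nth_le[of "a - b" i]
        by (intro mult_left_mono) auto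
      finally show "nuclear_norm (u$i *\<^sub>R herm_part ((a - b)$i)) \<le> norm u * (c * norm (a - b))"
        unfolding nuclear_norm_scaleR
        using component_le_norm_cart[of u i] nuclear_norm_nonneg by (intro mult_mono) auto
    qed
    also have "\<dots> = c' * norm u * norm (a - b)"
      by (simp add: c'_def)
    finally show ?thesis .
  qed
  moreover have "0 \<le> c'" using c(1) by (simp add: c'_def)
  ultimately show thesis using that by blast
qed

text \<open>The null set in \<open>linear_L1\<close> depends on the vectors and scalars; induction
  over \<open>I\<close> combines finitely many of them.\<close>

lemma linear_L1_sum:
  fixes T :: "real^'d \<Rightarrow> real \<Rightarrow> complex^'m^'m"
  assumes T: "linear_L1 T" and "finite I"
  shows "AE \<omega> in lebesgue_on {0..1}. T (\<Sum>i\<in>I. c i *\<^sub>R e i) \<omega> = (\<Sum>i\<in>I. c i *\<^sub>R T (e i) \<omega>)"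
  using \<open>finite I\<close>
proof (induction I rule: finite_induct)
  case empty
  \<comment> \<open>Taking all vectors and coefficients 0 in \<open>linear_L1\<close> shows that
    \<open>T 0\<close> vanishes almost everywhere.\<close>
  show ?case
    using T[unfolded linear_L1_def, rule_format, of 0 0 0 0] by simp
next
  case (insert k I)
  have "AE \<omega> in lebesgue_on {0..1}.
      T (c k *\<^sub>R e k + 1 *\<^sub>R (\<Sum>i\<in>I. c i *\<^sub>R e i)) \<omega> = c k *\<^sub>R T (e k) \<omega> + 1 *\<^sub>R T (\<Sum>i\<in>I. c i *\<^sub>R e i) \<omega>"
    using T unfolding linear_L1_def by blast
  then show ?case
    using insert.IH by eventually_elim (simp add: insert.hyps)
qed

lemma linear_L1_coordinates:
  assumes "linear_L1 T"
  shows "AE \<omega> in lebesgue_on {0..1}. T x \<omega> = (\<Sum>i\<in>UNIV. x$i *\<^sub>R T (axis i 1) \<omega>)"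
proof -
  have "(\<Sum>i\<in>UNIV. x$i *\<^sub>R axis i 1) = x"
    using basis_expansion[of x] by (simp add: scalar_mult_eq_scaleR)
  then show ?thesis
    using linear_L1_sum[OF assms, where I = UNIV and c = "\<lambda>i. x$i" and e = "\<lambda>i. axis i 1"] by simp
qed

text \<open>A simple function has finitely many values, so the integral is a finite sum of
  \<open>q u y\<close> weighted by the measures of the fibres; homogeneity moves each weight into
  the matrices.\<close>

lemma simple_integral_operatope:
  fixes s :: "'a \<Rightarrow> (complex^'m^'m)^'d"
  assumes s: "Bochner_Integration.simple_bochner_integrable M s"
  obtains S where "operatope TYPE('m) S"
    "\<And>u. integrable M (\<lambda>\<omega>. nuclear_norm (\<Sum>i\<in>UNIV. u$i *\<^sub>R herm_part (s \<omega> $ i)))"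
    "\<And>u. support_fun S u = (\<integral>\<omega>. nuclear_norm (\<Sum>i\<in>UNIV. u$i *\<^sub>R herm_part (s \<omega> $ i)) \<partial>M)"
proof -
  define q :: "real^'d \<Rightarrow> (complex^'m^'m)^'d \<Rightarrow> real"
    where "q u a = nuclear_norm (\<Sum>i\<in>UNIV. u$i *\<^sub>R herm_part (a$i))" for u a
  \<comment> \<open>Vanishing at 0 keeps the composition with \<open>s\<close> supported on a set of
    finite measure; the fibre over 0, possibly of infinite measure, contributes nothing.\<close>
  have q0: "q u 0 = 0" for u
    by (simp add: q_def linear_0[OF linear_herm_part])
  define w where "w y = measure M {x \<in> space M. s x = y}" for y
  have sf: "simple_function M s"
    using s by (rule simple_bochner_integrable.cases)
  have qs: "Bochner_Integration.simple_bochner_integrable M (\<lambda>\<omega>. q u (s \<omega>))" for u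
    using simple_bochner_integrable_compose2[of "\<lambda>a _. q u a", OF q0 s s] .
  have int: "(\<integral>\<omega>. q u (s \<omega>) \<partial>M) = (\<Sum>y\<in>s ` space M. w y * q u y)" for u
    using simple_bochner_integral_partition[OF qs[of u] sf, of "q u"]
    by (simp add: simple_bochner_integrable_eq_integral[OF qs] w_def)
  have "finite (s ` space M)"
    using sf by (simp add: simple_function_def)
  then obtain y where y: "bij_betw y {0..<card (s ` space M)} (s ` space M)"
    using ex_bij_betw_nat_finite by blast
  define A where "A j i = w (y j) *\<^sub>R herm_part (y j $ i)" for j i
  obtain S where S: "operatope TYPE('m) S"
    "\<And>u. support_fun S u = (\<Sum>j<card (s ` space M). nuclear_norm (\<Sum>i\<in>UNIV. u$i *\<^sub>R A j i))"
    by (rule operatope_nuclear_norm_body[of "card (s ` space M)" A])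
      (auto simp: A_def linear_scale[OF linear_herm_part, symmetric] hermitian_herm_part)
  have "nuclear_norm (\<Sum>i\<in>UNIV. u$i *\<^sub>R A j i) = w (y j) * q u (y j)" for u j
  proof -
    have "(\<Sum>i\<in>UNIV. u$i *\<^sub>R A j i) = w (y j) *\<^sub>R (\<Sum>i\<in>UNIV. u$i *\<^sub>R herm_part (y j $ i))"
      by (simp add: A_def scaleR_sum_right mult.commute)
    then show ?thesis
      by (simp add: nuclear_norm_scaleR q_def w_def)
  qed
  then have "support_fun S u = (\<integral>\<omega>. q u (s \<omega>) \<partial>M)" for u
    unfolding S(2) int using sum.reindex_bij_betw[OF y, of "\<lambda>y. w y * q u y"]
    by (simp add: atLeast0LessThan)
  then show thesis
    using S(1) that integrableI_simple_bochner_integrable[OF qs] unfolding q_def by blast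
qed

text \<open>The images of the coordinate vectors are bundled into one integrable tuple
  \<open>f\<close>, so a single simple approximation in L^1 works for every direction
  \<open>u\<close>.\<close>

lemma L1_embedding_imp_operatope_near:
  fixes Z :: "(real^'d) set" and T :: "real^'d \<Rightarrow> real \<Rightarrow> complex^'m^'m"
  assumes Z: "convex_body Z"
    and T: "\<And>x. L1_herm (T x)" "linear_L1 T" "\<And>x. L1_norm (T x) = support_fun Z x"
    and "0 < \<epsilon>"
  shows "\<exists>S. operatope TYPE('m) S \<and> hausdorff_dist S Z \<le> \<epsilon>"
proof -
  let ?M = "lebesgue_on {0..1::real}"
  define F where "F i = T (axis i 1)" for i
  define f where "f \<omega> = (\<Sum>i\<in>UNIV. axis i (F i \<omega>))" for \<omega>
  define q :: "real^'d \<Rightarrow> (complex^'m^'m)^'d \<Rightarrow> real"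
    where "q u a = nuclear_norm (\<Sum>i\<in>UNIV. u$i *\<^sub>R herm_part (a$i))" for u a
  have f_nth: "f \<omega> $ i = F i \<omega>" for \<omega> i
    by (simp add: f_def axis_def)
  have F_int: "integrable ?M (F i)" for i
  proof (rule Bochner_Integration.integrable_bound)
    show "integrable ?M (\<lambda>\<omega>. trace_norm (F i \<omega>))" "F i \<in> borel_measurable ?M"
      using T(1)[of "axis i 1"] by (auto simp: L1_herm_def F_def)
    show "AE \<omega> in ?M. norm (F i \<omega>) \<le> norm (trace_norm (F i \<omega>))"
    proof (rule AE_I2)
      fix \<omega> assume "\<omega> \<in> space ?M"
      then have "hermitian (F i \<omega>)"
        using T(1)[of "axis i 1"] by (simp add: L1_herm_def F_def)
      from norm_le_trace_norm[OF this] show "norm (F i \<omega>) \<le> norm (trace_norm (F i \<omega>))"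
        by simp
    qed
  qed
  have bl: "bounded_linear (axis i :: complex^'m^'m \<Rightarrow> (complex^'m^'m)^'d)" for i
    unfolding linear_conv_bounded_linear[symmetric]
    by (rule linearI) (simp_all add: axis_def vec_eq_iff)
  have f_int: "integrable ?M f"
    unfolding f_def
    by (intro Bochner_Integration.integrable_sum integrable_bounded_linear[OF bl F_int])
  have h: "support_fun Z u = (\<integral>\<omega>. q u (f \<omega>) \<partial>?M)"
    and q_int: "integrable ?M (\<lambda>\<omega>. q u (f \<omega>))" for u
  proof -
    \<comment> \<open>The exceptional null set may vary with \<open>u\<close>; this is harmless
      because integrals are compared one \<open>u\<close> at a time.\<close>
    have "AE \<omega> in ?M. trace_norm (T u \<omega>) = q u (f \<omega>)"
      using linear_L1_coordinates[OF T(2), of u] AE_space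
    proof eventually_elim
      case (elim \<omega>)
      have herm: "hermitian (T x \<omega>)" for x
        using elim(2) T(1)[of x] by (simp add: L1_herm_def)
      have "q u (f \<omega>) = nuclear_norm (T u \<omega>)"
        unfolding elim(1) q_def f_nth by (simp add: F_def herm_part_hermitian[OF herm])
      then show ?case
        by (simp add: trace_norm_eq_nuclear_norm[OF herm])
    qed
    note AE = this
    have "continuous_on UNIV (q u)"
      unfolding q_def
      by (intro continuous_on_compose2[OF continuous_on_nuclear_norm[of UNIV]] continuous_intros
          linear_continuous_on_compose[OF _ linear_herm_part]) auto
    then have meas: "(\<lambda>\<omega>. q u (f \<omega>)) \<in> borel_measurable ?M"
      by (rule measurable_compose[OF borel_measurable_integrable[OF f_int] borel_measurable_continuous_onI])
    have tr: "integrable ?M (\<lambda>\<omega>. trace_norm (T u \<omega>))"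
      using T(1)[of u] by (simp add: L1_herm_def)
    from integrable_cong_AE_imp[OF this meas] AE show "integrable ?M (\<lambda>\<omega>. q u (f \<omega>))"
      by (simp add: eq_commute)
    have "support_fun Z u = (\<integral>\<omega>. trace_norm (T u \<omega>) \<partial>?M)"
      using T(3)[of u] by (simp add: L1_norm_def)
    also have "\<dots> = (\<integral>\<omega>. q u (f \<omega>) \<partial>?M)"
      by (rule integral_cong_AE[OF borel_measurable_integrable[OF tr] meas AE])
    finally show "support_fun Z u = (\<integral>\<omega>. q u (f \<omega>) \<partial>?M)" .
  qed
  obtain c where c: "0 \<le> c" "\<And>u a b. \<bar>q u a - q u b\<bar> \<le> c * norm u * norm (a - b)"
    unfolding q_def using nuclear_norm_combination_lipschitz by blast
  \<comment> \<open>The definition of the Bochner integral itself supplies simple functions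
    converging in L^1.\<close>
  obtain I where "has_bochner_integral ?M f I"
    using f_int by (auto elim: integrable.cases)
  then obtain s where s: "\<And>k. Bochner_Integration.simple_bochner_integrable ?M (s k)"
    "(\<lambda>k. \<integral>\<^sup>+\<omega>. norm (f \<omega> - s k \<omega>) \<partial>?M) \<longlonglongrightarrow> 0"
    by (rule has_bochner_integral.cases) blast
  \<comment> \<open>Dividing by \<open>c + 1\<close> avoids a zero denominator and still gives
    \<open>c * \<delta> \<le> \<epsilon>\<close>.\<close>
  define \<delta> where "\<delta> = \<epsilon> / (c + 1)"
  have "0 < \<delta>" using \<open>0 < \<epsilon>\<close> c(1) by (simp add: \<delta>_def)
  then have "\<forall>\<^sub>F k in sequentially. (\<integral>\<^sup>+\<omega>. norm (f \<omega> - s k \<omega>) \<partial>?M) < ennreal \<delta>"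
    using s(2) by (intro order_tendstoD) auto
  then obtain k where k: "(\<integral>\<^sup>+\<omega>. norm (f \<omega> - s k \<omega>) \<partial>?M) < ennreal \<delta>"
    by (auto dest: eventually_happens)
  have d_int: "integrable ?M (\<lambda>\<omega>. norm (f \<omega> - s k \<omega>))"
    using f_int integrableI_simple_bochner_integrable[OF s(1)[of k]] by auto
  have "ennreal (\<integral>\<omega>. norm (f \<omega> - s k \<omega>) \<partial>?M) < ennreal \<delta>"
    using k nn_integral_eq_integral[OF d_int] by simp
  then have d_le: "(\<integral>\<omega>. norm (f \<omega> - s k \<omega>) \<partial>?M) \<le> \<delta>"
    using \<open>0 < \<delta>\<close> by (simp add: ennreal_less_iff)
  obtain S where S: "operatope TYPE('m) S" "\<And>u. integrable ?M (\<lambda>\<omega>. q u (s k \<omega>))"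
    "\<And>u. support_fun S u = (\<integral>\<omega>. q u (s k \<omega>) \<partial>?M)"
    using simple_integral_operatope[OF s(1)[of k]] unfolding q_def by blast
  have "\<bar>support_fun S u - support_fun Z u\<bar> \<le> \<epsilon> * norm u" for u
  proof -
    have "\<bar>support_fun S u - support_fun Z u\<bar> = \<bar>\<integral>\<omega>. q u (s k \<omega>) - q u (f \<omega>) \<partial>?M\<bar>"
      by (simp add: S h Bochner_Integration.integral_diff[OF S(2) q_int])
    also have "\<dots> \<le> (\<integral>\<omega>. \<bar>q u (s k \<omega>) - q u (f \<omega>)\<bar> \<partial>?M)"
      by (rule integral_abs_bound)
    also have "\<dots> \<le> (\<integral>\<omega>. c * norm u * norm (f \<omega> - s k \<omega>) \<partial>?M)"
      using c(2)[of u "s k _" "f _"] d_int q_int S(2)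
      by (intro integral_mono) (auto simp: norm_minus_commute[of "f _"])
    also have "\<dots> = c * norm u * (\<integral>\<omega>. norm (f \<omega> - s k \<omega>) \<partial>?M)"
      by simp
    also have "\<dots> \<le> c * norm u * \<delta>"
      using d_le c(1) by (intro mult_left_mono) auto
    also have "\<dots> \<le> \<epsilon> * norm u"
    proof -
      have "c * \<delta> \<le> \<epsilon>"
        using c(1) \<open>0 < \<epsilon>\<close> by (simp add: \<delta>_def field_simps)
      then show ?thesis
        using mult_right_mono[of "c * \<delta>" \<epsilon> "norm u"] by (simp add: mult_ac)
    qed
    finally show ?thesis .
  qed
  moreover have "convex_body S" using S(1) by (simp add: operatope_def)
  ultimately have "hausdorff_dist S Z \<le> \<epsilon>"
    using hausdorff_dist_le_support_fun_diff[OF _ Z] \<open>0 < \<epsilon>\<close> by simp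
  then show ?thesis using S(1) by blast
qed

lemma operanoidI:
  assumes Z: "convex_body Z" "centrally_symmetric Z"
    and near: "\<And>\<epsilon>. 0 < \<epsilon> \<Longrightarrow> \<exists>S. operatope TYPE('m::finite) S \<and> hausdorff_dist S Z \<le> \<epsilon>"
  shows "operanoid TYPE('m) Z"
proof -
  have "\<exists>S. \<forall>k. operatope TYPE('m) (S k) \<and> hausdorff_dist (S k) Z \<le> 1 / real (Suc k)"
    by (intro choice allI near) simp
  then obtain S where S: "\<And>k. operatope TYPE('m) (S k)" "\<And>k. hausdorff_dist (S k) Z \<le> 1 / real (Suc k)"
    by blast
  have "(\<lambda>k. hausdorff_dist (S k) Z) \<longlonglongrightarrow> 0"
  proof (rule tendsto_sandwich[OF _ _ tendsto_const LIMSEQ_Suc[OF lim_1_over_n]])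
    show "\<forall>\<^sub>F k in sequentially. 0 \<le> hausdorff_dist (S k) Z"
      using S(1) by (intro always_eventually) (auto simp: operatope_def intro: hausdorff_dist_nonneg)
  qed (use S(2) in auto)
  then show ?thesis
    unfolding operanoid_def using Z S(1) by blast
qed

section \<open>From operatopes to embeddings\<close>

lemma bounded_distributions_limit_on_unit_interval:
  fixes \<mu> :: "nat \<Rightarrow> real measure"
  assumes \<mu>: "\<And>n. real_distribution (\<mu> n)" and C: "compact C" "\<And>n. measure (\<mu> n) C = 1"
  obtains \<tau> :: "real \<Rightarrow> real" and r :: "nat \<Rightarrow> nat" where "\<tau> \<in> borel_measurable borel" "strict_mono r"
    "\<forall>F. continuous_on UNIV F \<and> bounded (range F) \<longrightarrow>
      (\<lambda>n. \<integral>t. F t \<partial>\<mu> (r n)) \<longlonglongrightarrow> (\<integral>\<omega>. (F (\<tau> \<omega>) :: real) \<partial>lebesgue_on {0..1})"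
proof -
  obtain b where b: "0 < b" "\<And>x. x \<in> C \<Longrightarrow> \<bar>x\<bar> \<le> b"
    using compact_imp_bounded[OF C(1)] by (auto simp: bounded_pos)
  have "tight \<mu>"
    unfolding tight_def
  proof (intro conjI allI impI)
    fix \<epsilon> :: real assume "0 < \<epsilon>"
    \<comment> \<open>The interval is open on the left, so its left end is taken below
      \<open>- b\<close>.\<close>
    have "1 \<le> measure (\<mu> n) {- b - 1<..b}" for n
    proof -
      interpret real_distribution "\<mu> n" by (rule \<mu>)
      have "measure (\<mu> n) C \<le> measure (\<mu> n) {- b - 1<..b}"
        using b by (intro finite_measure_mono) (force simp: abs_le_iff)+
      then show ?thesis using C(2) by simp
    qed
    then have "1 - \<epsilon> < measure (\<mu> n) {- b - 1<..b}" for n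
      using \<open>0 < \<epsilon>\<close> by (smt (verit))
    then show "\<exists>a b. a < b \<and> (\<forall>n. 1 - \<epsilon> < measure (\<mu> n) {a<..b})"
      using b(1) by (intro exI[of _ "- b - 1"] exI[of _ b]) auto
  qed (rule \<mu>)
  then obtain r N where r: "strict_mono r" and N: "real_distribution N"
    and conv: "weak_conv_m (\<mu> \<circ> id \<circ> r) N"
    using tight_imp_convergent_subsubsequence[OF _ strict_mono_id] by blast
  interpret N: cdf_distribution N
    unfolding cdf_distribution_def by (rule N)
  \<comment> \<open>\<open>N.I\<close> is the quantile function of the limit law, meaningful only
    inside the open interval; the two endpoints form a null set, so the default 0 does not affect
    integrals over the closed one.\<close>
  define \<tau> where "\<tau> \<omega> = (if \<omega> \<in> {0<..<1} then N.I \<omega> else 0)" for \<omega> :: real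
  have \<tau>[measurable]: "\<tau> \<in> borel_measurable borel"
    unfolding \<tau>_def using N.measurable_CI
    by (subst (asm) measurable_restrict_space_iff[where c = 0]) auto
  have "(\<lambda>n. \<integral>t. F t \<partial>\<mu> (r n)) \<longlonglongrightarrow> (\<integral>\<omega>. F (\<tau> \<omega>) \<partial>lebesgue_on {0..1})"
    if F: "continuous_on UNIV F" "bounded (range F)" for F :: "real \<Rightarrow> real"
  proof -
    obtain B where "\<And>t. \<bar>F t\<bar> \<le> B"
      using F(2) by (auto simp: bounded_iff)
    have F_meas[measurable]: "F \<in> borel_measurable borel"
      by (rule borel_measurable_continuous_onI[OF F(1)])
    have "(\<lambda>n. \<integral>t. F t \<partial>(\<mu> \<circ> id \<circ> r) n) \<longlonglongrightarrow> (\<integral>t. F t \<partial>N)"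
      by (rule weak_conv_imp_integral_bdd_continuous_conv[OF _ N conv, where B = B])
        (use \<mu> F(1) \<open>\<And>t. \<bar>F t\<bar> \<le> B\<close> in \<open>auto simp: continuous_on_eq_continuous_at\<close>)
    moreover have "(\<integral>t. F t \<partial>N) = (\<integral>\<omega>. F (\<tau> \<omega>) \<partial>lebesgue_on {0..1})"
    proof -
      \<comment> \<open>The quantile function pushes Lebesgue measure on the open unit interval
        forward to \<open>N\<close>; the remaining equations add the endpoints and complete the
        measure.\<close>
      have "(\<integral>t. F t \<partial>N) = (\<integral>\<omega>. F (N.I \<omega>) \<partial>restrict_space lborel {0<..<1})"
        by (subst N.distr_I_eq_M[symmetric]) (rule integral_distr; measurable)
      also have "\<dots> = (\<integral>\<omega>. indicator {0<..<1} \<omega> *\<^sub>R F (N.I \<omega>) \<partial>lborel)"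
        by (rule integral_restrict_space) simp
      also have "\<dots> = (\<integral>\<omega>. indicator {0<..<1} \<omega> *\<^sub>R F (\<tau> \<omega>) \<partial>lborel)"
        by (intro Bochner_Integration.integral_cong) (auto simp: \<tau>_def split: split_indicator)
      also have "\<dots> = (\<integral>\<omega>. indicator {0..1} \<omega> *\<^sub>R F (\<tau> \<omega>) \<partial>lborel)"
        using AE_lborel_singleton[of "0::real"] AE_lborel_singleton[of "1::real"]
        by (intro integral_cong_AE) (measurable, auto split: split_indicator)
      also have "\<dots> = (\<integral>\<omega>. indicator {0..1} \<omega> *\<^sub>R F (\<tau> \<omega>) \<partial>lebesgue)"
        by (rule integral_completion[symmetric]) measurable
      also have "\<dots> = (\<integral>\<omega>. F (\<tau> \<omega>) \<partial>lebesgue_on {0..1})"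
        by (rule integral_restrict_space[symmetric]) simp
      finally show ?thesis .
    qed
    ultimately show ?thesis by simp
  qed
  then show thesis
    using that \<tau> r by blast
qed

lemma finite_weights_distribution:
  fixes p t :: "nat \<Rightarrow> real"
  assumes p: "\<And>j. j < N \<Longrightarrow> 0 \<le> p j" "(\<Sum>j<N. p j) = 1" and t: "\<And>j. t j \<in> C"
    and C: "C \<in> sets borel"
  obtains \<mu> where "real_distribution \<mu>" "measure \<mu> C = 1"
    "\<And>F :: real \<Rightarrow> real. F \<in> borel_measurable borel \<Longrightarrow> (\<integral>x. F x \<partial>\<mu>) = (\<Sum>j<N. p j * F (t j))"
proof -
  define p' where "p' j = (if j < N then p j else 0)" for j
  have "(\<integral>\<^sup>+j. ennreal (p' j) \<partial>count_space UNIV) = (\<Sum>j<N. ennreal (p' j))"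
    by (rule nn_integral_count_space'[where A = "{..<N}"]) (auto simp: p'_def)
  also have "\<dots> = ennreal (\<Sum>j<N. p' j)"
    by (rule sum_ennreal) (simp add: p'_def p)
  also have "(\<Sum>j<N. p' j) = 1"
    using p(2) by (simp add: p'_def)
  finally have one: "(\<integral>\<^sup>+j. ennreal (p' j) \<partial>count_space UNIV) = 1"
    by simp
  have nonneg: "\<And>j. 0 \<le> p' j" using p(1) by (simp add: p'_def)
  define P where "P = embed_pmf p'"
  have pmf_P: "pmf P j = p' j" for j
    unfolding P_def by (rule pmf_embed_pmf[OF nonneg one])
  define \<mu> where "\<mu> = distr (measure_pmf P) borel t"
  show thesis
  proof
    show "real_distribution \<mu>"
      unfolding \<mu>_def by (rule prob_space.real_distribution_distr[OF measure_pmf.prob_space_axioms]) simp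
    show "measure \<mu> C = 1"
      unfolding \<mu>_def using t C by (subst measure_distr) (auto simp: vimage_def)
    show "(\<integral>x. F x \<partial>\<mu>) = (\<Sum>j<N. p j * F (t j))" if "F \<in> borel_measurable borel" for F :: "real \<Rightarrow> real"
    proof -
      have "(\<integral>x. F x \<partial>\<mu>) = (\<integral>j. F (t j) \<partial>measure_pmf P)"
        unfolding \<mu>_def by (rule integral_distr) (use that in auto)
      also have "\<dots> = (\<Sum>j<N. F (t j) * pmf P j)"
        by (rule integral_measure_pmf_real) (auto simp: set_pmf_iff pmf_P p'_def split: if_splits)
      finally show ?thesis
        by (simp add: pmf_P p'_def mult.commute)
    qed
  qed
qed

text \<open>A finite family of total norm at most \<open>W\<close> becomes a probability measure on unit vectors,
  the missing mass being put at 0, where positively homogeneous functions vanish.\<close>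

lemma finite_family_distribution:
  fixes \<phi> :: "real \<Rightarrow> 'a::euclidean_space" and a :: "nat \<Rightarrow> 'a"
  assumes V: "subspace V" and C: "compact C" and \<phi>: "\<phi> ` C = V \<inter> cball 0 1"
    and a: "\<And>j. j < N \<Longrightarrow> a j \<in> V" and W: "0 < W" "(\<Sum>j<N. norm (a j)) \<le> W"
  obtains \<mu> where "real_distribution \<mu>" "measure \<mu> C = 1"
    "\<And>q. (\<lambda>t. q (\<phi> t)) \<in> borel_measurable borel \<Longrightarrow> (\<And>r x. 0 \<le> r \<Longrightarrow> q (r *\<^sub>R x) = r * q x) \<Longrightarrow>
      W * (\<integral>t. q (\<phi> t) \<partial>\<mu>) = (\<Sum>j<N. q (a j))"
proof -
  define n where "n j = (if j < N then (1 / norm (a j)) *\<^sub>R a j else 0)" for j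
  \<comment> \<open>Index \<open>N\<close> is reserved for the missing mass, located at
    \<open>n N = 0\<close>; hence the sums up to \<open>Suc N\<close> below.\<close>
  define p where "p j = (if j < N then norm (a j) / W else 1 - (\<Sum>j<N. norm (a j)) / W)" for j
  have "n j \<in> V \<inter> cball 0 1" for j
    using a V by (auto simp: n_def subspace_0 subspace_scale)
  then have "\<exists>t\<in>C. \<phi> t = n j" for j
    unfolding \<phi>[symmetric] by (metis imageE)
  then obtain t where t: "\<And>j. t j \<in> C" "\<And>j. \<phi> (t j) = n j"
    by metis
  have "\<And>j. j < Suc N \<Longrightarrow> 0 \<le> p j" "(\<Sum>j<Suc N. p j) = 1"
    using W by (simp_all add: p_def flip: sum_divide_distrib)
  then obtain \<mu> where \<mu>: "real_distribution \<mu>" "measure \<mu> C = 1"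
    "\<And>F :: real \<Rightarrow> real. F \<in> borel_measurable borel \<Longrightarrow> (\<integral>x. F x \<partial>\<mu>) = (\<Sum>j<Suc N. p j * F (t j))"
    using finite_weights_distribution[of "Suc N" p t C] t(1) borel_compact[OF C] by metis
  have "W * (\<integral>t. q (\<phi> t) \<partial>\<mu>) = (\<Sum>j<N. q (a j))"
    if meas: "(\<lambda>t. q (\<phi> t)) \<in> borel_measurable borel"
      and hom: "\<And>r x. 0 \<le> r \<Longrightarrow> q (r *\<^sub>R x) = r * q x" for q
  proof -
    have q0: "q 0 = 0" using hom[of 0 0] by simp
    have "W * (p j * q (n j)) = q (a j)" if "j < N" for j
    proof (cases "a j = 0")
      case False
      then show ?thesis
        using that W(1) hom[of "norm (a j)" "n j"] by (simp add: n_def p_def)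
    qed (simp add: that p_def q0)
    then show ?thesis
      by (simp add: \<mu>(3)[OF meas] t(2) sum_distrib_left distrib_left) (simp add: n_def q0)
  qed
  then show thesis using \<mu>(1,2) that by blast
qed

text \<open>Hausdorff convergence enters only through pointwise convergence of support functions.
  The approximating operatopes may have other centres, while the limit is symmetric about 0.\<close>

lemma operanoid_support_fun_limit:
  fixes Z :: "(real^'d) set"
  assumes Z: "convex_body Z" "\<forall>x. x \<in> Z \<longleftrightarrow> - x \<in> Z" and op: "operanoid TYPE('m::finite) Z"
  obtains N and A :: "nat \<Rightarrow> nat \<Rightarrow> 'd \<Rightarrow> complex^'m^'m"
  where "\<And>k j i. j < N k \<Longrightarrow> hermitian (A k j i)"
    "\<And>u. (\<lambda>k. \<Sum>j<N k. nuclear_norm (\<Sum>i\<in>UNIV. u$i *\<^sub>R A k j i)) \<longlonglongrightarrow> support_fun Z u"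
proof -
  obtain S where S: "\<And>k. operatope TYPE('m) (S k)" "(\<lambda>k. hausdorff_dist (S k) Z) \<longlonglongrightarrow> 0"
    using op unfolding operanoid_def by blast
  have S_body: "convex_body (S k)" for k
    using S(1)[of k] by (simp add: operatope_def)
  \<comment> \<open>One predicate for all data of \<open>S k\<close>, so that a single choice yields
    \<open>N\<close>, \<open>v\<close> and \<open>A\<close> together.\<close>
  define P where "P k M w B \<longleftrightarrow> (\<forall>j<M. \<forall>i. hermitian (B j i)) \<and>
      (\<forall>u. support_fun (S k) u = w \<bullet> u + (\<Sum>j<M. trace_norm (\<Sum>i\<in>UNIV. (u$i) *\<^sub>R B j i)))"
    for k and M :: nat and w and B :: "nat \<Rightarrow> 'd \<Rightarrow> complex^'m^'m"
  have "\<exists>M w B. P k M w B" for k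
    using S(1)[of k] unfolding operatope_def P_def by blast
  then obtain N v A where P: "\<And>k. P k (N k) (v k) (A k)"
    by metis
  have A: "hermitian (A k j i)" if "j < N k" for k j i
    using P[of k] that by (simp add: P_def)
  have tr: "support_fun (S k) u = v k \<bullet> u + (\<Sum>j<N k. trace_norm (\<Sum>i\<in>UNIV. (u$i) *\<^sub>R A k j i))" for k u
    using P[of k] by (simp add: P_def)
  have sf: "support_fun (S k) u = v k \<bullet> u + (\<Sum>j<N k. nuclear_norm (\<Sum>i\<in>UNIV. (u$i) *\<^sub>R A k j i))" for k u
    unfolding tr using A by (simp add: trace_norm_eq_nuclear_norm hermitian_sum_scaleR)
  have lim: "(\<lambda>k. support_fun (S k) u) \<longlonglongrightarrow> support_fun Z u" for u
  proof (rule LIM_zero_cancel, rule Lim_null_comparison)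
    show "\<forall>\<^sub>F k in sequentially.
        norm (support_fun (S k) u - support_fun Z u) \<le> hausdorff_dist (S k) Z * norm u"
      using support_fun_diff_le_hausdorff_dist[OF S_body Z(1)] by (intro always_eventually) simp
    show "(\<lambda>k. hausdorff_dist (S k) Z * norm u) \<longlonglongrightarrow> 0"
      using tendsto_mult_right[OF S(2), of "norm u"] by simp
  qed
  have sym: "support_fun Z (- u) = support_fun Z u" for u
  proof -
    have le: "support_fun Z (- w) \<le> support_fun Z w" for w
      using Z(2) support_fun_upper[OF Z(1), of _ w]
      by (intro support_fun_least[OF Z(1)]) (metis inner_minus_left inner_minus_right)
    from le[of u] le[of "- u"] show ?thesis by simp
  qed
  \<comment> \<open>averaging over \<open>u\<close> and \<open>- u\<close> removes the translation vectors \<open>v k\<close>\<close>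
  have avg: "(support_fun (S k) u + support_fun (S k) (- u)) / 2
      = (\<Sum>j<N k. nuclear_norm (\<Sum>i\<in>UNIV. u$i *\<^sub>R A k j i))" for k u
  proof -
    have "(\<Sum>i\<in>UNIV. (- u)$i *\<^sub>R A k j i) = - (\<Sum>i\<in>UNIV. u$i *\<^sub>R A k j i)" for j
      by (simp add: sum_negf)
    then show ?thesis
      unfolding sf by (simp only: nuclear_norm_minus) simp
  qed
  have "(\<lambda>k. (support_fun (S k) u + support_fun (S k) (- u)) / 2) \<longlonglongrightarrow>
      (support_fun Z u + support_fun Z (- u)) / 2" for u
    by (intro tendsto_intros lim) simp
  then have "(\<lambda>k. \<Sum>j<N k. nuclear_norm (\<Sum>i\<in>UNIV. u$i *\<^sub>R A k j i)) \<longlonglongrightarrow> support_fun Z u" for u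
    unfolding avg by (simp add: sym)
  then show thesis using A that by blast
qed

text \<open>All data of the \<open>k\<close>-th operatope go into one measure
  \<open>\<mu> k\<close>, chosen before \<open>u\<close>. Hence one subsequence and one
  \<open>\<tau>\<close> represent the limit in every direction, and linearity comes from the pencil
  that defines \<open>T\<close>.\<close>

lemma operanoid_imp_L1_embedding:
  fixes Z :: "(real^'d) set"
  assumes Z: "convex_body Z" "\<forall>x. x \<in> Z \<longleftrightarrow> - x \<in> Z" and op: "operanoid TYPE('m::finite) Z"
  shows "\<exists>T :: real^'d \<Rightarrow> real \<Rightarrow> complex^'m^'m.
    (\<forall>x. L1_herm (T x)) \<and> linear_L1 T \<and> (\<forall>x. L1_norm (T x) = support_fun Z x)"
proof -
  obtain N and A :: "nat \<Rightarrow> nat \<Rightarrow> 'd \<Rightarrow> complex^'m^'m"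
    where A: "\<And>k j i. j < N k \<Longrightarrow> hermitian (A k j i)"
    and lim: "\<And>u. (\<lambda>k. \<Sum>j<N k. nuclear_norm (\<Sum>i\<in>UNIV. u$i *\<^sub>R A k j i)) \<longlonglongrightarrow> support_fun Z u"
    using operanoid_support_fun_limit[OF Z op] by blast
  define V :: "((complex^'m^'m)^'d) set" where "V = {a. \<forall>i. hermitian (a$i)}"
  define q :: "real^'d \<Rightarrow> (complex^'m^'m)^'d \<Rightarrow> real"
    where "q u a = nuclear_norm (\<Sum>i\<in>UNIV. u$i *\<^sub>R a$i)" for u a
  define a where "a k j = (\<chi> i. A k j i)" for k j
  have aV: "a k j \<in> V" if "j < N k" for k j
    using A[OF that] by (simp add: a_def V_def)
  have qa: "(\<Sum>j<N k. q u (a k j)) = (\<Sum>j<N k. nuclear_norm (\<Sum>i\<in>UNIV. u$i *\<^sub>R A k j i))" for k u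
    by (simp add: q_def a_def)
  have subV: "subspace V"
    by (auto simp: subspace_def V_def hermitian_iff_adj linear_add[OF linear_adj]
        linear_scale[OF linear_adj] linear_0[OF linear_adj])
  have "compact (V \<inter> cball 0 1)" "convex (V \<inter> cball 0 1)" "V \<inter> cball 0 1 \<noteq> {}"
    using subV by (auto intro: closed_Int_compact closed_subspace convex_Int subspace_imp_convex
        dest: subspace_0)
  then obtain \<phi> :: "real \<Rightarrow> (complex^'m^'m)^'d" and C where \<phi>: "continuous_on UNIV \<phi>"
    "range \<phi> \<subseteq> V \<inter> cball 0 1" "compact C" "\<phi> ` C = V \<inter> cball 0 1"
    using compact_convex_real_parametrization by blast
  have q_cont: "continuous_on UNIV (q u)" for u
    unfolding q_def
    by (intro continuous_on_compose2[OF continuous_on_nuclear_norm[of UNIV]] continuous_intros) auto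
  then have q\<phi>_cont: "continuous_on UNIV (\<lambda>t. q u (\<phi> t))" for u
    by (rule continuous_on_compose2[OF _ \<phi>(1)]) auto
  have q_hom: "q u (r *\<^sub>R x) = r * q u x" if "0 \<le> r" for u r x
  proof -
    have "(\<Sum>i\<in>UNIV. u$i *\<^sub>R (r *\<^sub>R x)$i) = r *\<^sub>R (\<Sum>i\<in>UNIV. u$i *\<^sub>R x$i)"
      by (simp add: scaleR_sum_right mult.commute)
    then show ?thesis
      using that by (simp add: q_def nuclear_norm_scaleR)
  qed
  have q_bdd: "bounded (range (\<lambda>t. q u (\<phi> t)))" for u
  proof (rule bounded_subset)
    show "bounded (q u ` (V \<inter> cball 0 1))"
      using \<open>compact (V \<inter> cball 0 1)\<close> q_cont
      by (metis compact_continuous_image compact_imp_bounded continuous_on_subset subset_UNIV)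
  qed (use \<phi>(2) in auto)
  \<comment> \<open>\<open>q (axis i 1)\<close> is the nuclear norm of the \<open>i\<close>-th
    matrix, which dominates the Frobenius norm in the Hermitian case. The right-hand side converges
    with \<open>k\<close>, which bounds the masses.\<close>
  have mass: "(\<Sum>j<N k. norm (a k j)) \<le> (\<Sum>i\<in>UNIV. \<Sum>j<N k. q (axis i 1) (a k j))" for k
  proof -
    have "norm (a k j) \<le> (\<Sum>i\<in>UNIV. q (axis i 1) (a k j))" if "j < N k" for j
    proof -
      have "norm (a k j) \<le> (\<Sum>i\<in>UNIV. norm (a k j $ i))"
        unfolding norm_vec_def by (rule L2_set_le_sum) simp
      also have "\<dots> \<le> (\<Sum>i\<in>UNIV. q (axis i 1) (a k j))"
      proof (rule sum_mono)
        fix i :: 'd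
        have "(\<Sum>l\<in>UNIV. axis i 1 $ l *\<^sub>R a k j $ l) = a k j $ i"
          by (simp add: axis_def if_distrib[of "\<lambda>x. x *\<^sub>R _"] cong: if_cong)
        then show "norm (a k j $ i) \<le> q (axis i 1) (a k j)"
          using norm_le_trace_norm[of "a k j $ i"] trace_norm_eq_nuclear_norm[of "a k j $ i"] aV[OF that]
          by (simp add: q_def V_def)
      qed
      finally show ?thesis .
    qed
    then have "(\<Sum>j<N k. norm (a k j)) \<le> (\<Sum>j<N k. \<Sum>i\<in>UNIV. q (axis i 1) (a k j))"
      by (intro sum_mono) auto
    also have "\<dots> = (\<Sum>i\<in>UNIV. \<Sum>j<N k. q (axis i 1) (a k j))"
      by (rule sum.swap)
    finally show ?thesis .
  qed
  have "convergent (\<lambda>k. \<Sum>i\<in>UNIV. \<Sum>j<N k. q (axis i 1) (a k j))"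
    unfolding qa
    by (rule convergentI[where L = "\<Sum>i\<in>UNIV. support_fun Z (axis i 1)"]) (rule tendsto_sum, rule lim)
  then obtain W where W: "0 < W" "\<And>k. norm (\<Sum>i\<in>UNIV. \<Sum>j<N k. q (axis i 1) (a k j)) \<le> W"
    using BseqE[OF convergent_imp_Bseq, of "\<lambda>k. \<Sum>i\<in>UNIV. \<Sum>j<N k. q (axis i 1) (a k j)"] by blast
  have mass_le: "(\<Sum>j<N k. norm (a k j)) \<le> W" for k
    using mass[of k] W(2)[of k] by simp
  have "\<exists>\<mu>. real_distribution \<mu> \<and> measure \<mu> C = 1 \<and>
      (\<forall>u. W * (\<integral>t. q u (\<phi> t) \<partial>\<mu>) = (\<Sum>j<N k. q u (a k j)))" for k
  proof -
    obtain \<mu> where \<mu>: "real_distribution \<mu>" "measure \<mu> C = 1"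
      "\<And>q. (\<lambda>t. q (\<phi> t)) \<in> borel_measurable borel \<Longrightarrow> (\<And>r x. 0 \<le> r \<Longrightarrow> q (r *\<^sub>R x) = r * q x) \<Longrightarrow>
        W * (\<integral>t. q (\<phi> t) \<partial>\<mu>) = (\<Sum>j<N k. q (a k j))"
      using finite_family_distribution[OF subV \<phi>(3,4) _ W(1) mass_le] aV by blast
    have "W * (\<integral>t. q u (\<phi> t) \<partial>\<mu>) = (\<Sum>j<N k. q u (a k j))" for u
      by (rule \<mu>(3)[OF borel_measurable_continuous_onI[OF q\<phi>_cont] q_hom])
    then show ?thesis using \<mu>(1,2) by blast
  qed
  then obtain \<mu> where \<mu>: "\<And>k. real_distribution (\<mu> k)" "\<And>k. measure (\<mu> k) C = 1"
    "\<And>k u. W * (\<integral>t. q u (\<phi> t) \<partial>\<mu> k) = (\<Sum>j<N k. q u (a k j))"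
    by metis
  obtain \<tau> :: "real \<Rightarrow> real" and r where \<tau>: "\<tau> \<in> borel_measurable borel" and r: "strict_mono r"
    and conv: "\<forall>F. continuous_on UNIV F \<and> bounded (range F) \<longrightarrow>
      (\<lambda>n. \<integral>t. F t \<partial>\<mu> (r n)) \<longlonglongrightarrow> (\<integral>\<omega>. (F (\<tau> \<omega>) :: real) \<partial>lebesgue_on {0..1})"
    using bounded_distributions_limit_on_unit_interval[of \<mu>, OF \<mu>(1) \<phi>(3) \<mu>(2)] by blast
  \<comment> \<open>Two limits of the same subsequence: one from the Hausdorff approximation, the
    other from weak convergence with the bounded continuous integrand \<open>q u\<close> after
    \<open>\<phi>\<close>.\<close>
  have h: "support_fun Z u = W * (\<integral>\<omega>. q u (\<phi> (\<tau> \<omega>)) \<partial>lebesgue_on {0..1})" for u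
  proof (rule LIMSEQ_unique)
    show "(\<lambda>n. \<Sum>j<N (r n). q u (a (r n) j)) \<longlonglongrightarrow> support_fun Z u"
      unfolding qa using LIMSEQ_subseq_LIMSEQ[OF lim r, of u] by (simp add: comp_def)
    have "(\<lambda>n. \<integral>t. q u (\<phi> t) \<partial>\<mu> (r n)) \<longlonglongrightarrow> (\<integral>\<omega>. q u (\<phi> (\<tau> \<omega>)) \<partial>lebesgue_on {0..1})"
      using conv q\<phi>_cont q_bdd by blast
    from tendsto_mult_left[OF this, of W]
    show "(\<lambda>n. \<Sum>j<N (r n). q u (a (r n) j)) \<longlonglongrightarrow> W * (\<integral>\<omega>. q u (\<phi> (\<tau> \<omega>)) \<partial>lebesgue_on {0..1})"
      unfolding \<mu>(3) .
  qed
  \<comment> \<open>The factor \<open>W\<close>, divided out to obtain probability measures, is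
    returned to the matrices. This \<open>T\<close> is linear at every point
    \<open>\<omega>\<close>.\<close>
  define T :: "real^'d \<Rightarrow> real \<Rightarrow> complex^'m^'m"
    where "T u \<omega> = W *\<^sub>R (\<Sum>i\<in>UNIV. u$i *\<^sub>R \<phi> (\<tau> \<omega>) $ i)" for u \<omega>
  have \<tau>_leb: "\<tau> \<in> borel_measurable (lebesgue_on {0..1})"
    using \<tau> by (intro measurable_restrict_space1 measurable_completion) simp
  have T_herm: "hermitian (T u \<omega>)" for u \<omega>
  proof -
    \<comment> \<open>\<open>\<phi>\<close> takes values in \<open>V\<close> on the whole line, so
      this holds wherever \<open>\<tau> \<omega>\<close> lies.\<close>
    have "\<phi> (\<tau> \<omega>) \<in> V" using \<phi>(2) by blast
    then have "hermitian (\<Sum>i\<in>UNIV. (W * u$i) *\<^sub>R \<phi> (\<tau> \<omega>) $ i)"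
      by (intro hermitian_sum_scaleR) (simp add: V_def)
    then show ?thesis by (simp add: T_def scaleR_sum_right)
  qed
  then have T_norm: "trace_norm (T u \<omega>) = W * q u (\<phi> (\<tau> \<omega>))" for u \<omega>
    using W(1) by (simp add: trace_norm_eq_nuclear_norm T_def q_def nuclear_norm_scaleR)
  have "L1_herm (T u)" for u
    unfolding L1_herm_def
  proof (intro conjI ballI T_herm)
    have "continuous_on UNIV (\<lambda>t. W *\<^sub>R (\<Sum>i\<in>UNIV. u$i *\<^sub>R \<phi> t $ i))"
      by (intro continuous_intros \<phi>(1))
    then show "T u \<in> borel_measurable (lebesgue_on {0..1})"
      unfolding T_def by (rule measurable_compose[OF \<tau>_leb borel_measurable_continuous_onI])
    interpret finite_measure "lebesgue_on {0..1::real}"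
      by (rule finite_measure_lebesgue_on) simp
    obtain B where "\<And>t. \<bar>q u (\<phi> t)\<bar> \<le> B"
      using q_bdd[of u] by (auto simp: bounded_iff)
    then have "integrable (lebesgue_on {0..1}) (\<lambda>\<omega>. q u (\<phi> (\<tau> \<omega>)))"
      using measurable_compose[OF \<tau>_leb borel_measurable_continuous_onI[OF q\<phi>_cont]]
      by (intro integrable_const_bound[where B = B]) auto
    then show "integrable (lebesgue_on {0..1}) (\<lambda>\<omega>. trace_norm (T u \<omega>))"
      unfolding T_norm by simp
  qed
  moreover have "T (b *\<^sub>R x + c *\<^sub>R y) \<omega> = b *\<^sub>R T x \<omega> + c *\<^sub>R T y \<omega>" for b c x y \<omega>
    by (simp add: T_def scaleR_add_left sum.distrib scaleR_sum_right scaleR_add_right mult_ac)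
  then have "linear_L1 T"
    by (simp add: linear_L1_def)
  moreover have "L1_norm (T u) = support_fun Z u" for u
    by (simp add: L1_norm_def T_norm h)
  ultimately show ?thesis by blast
qed

theorem mainTheorem2:
  fixes Z :: "(real^'d) set"
  assumes "convex_body Z"
    and "\<forall>x. x \<in> Z \<longleftrightarrow> - x \<in> Z"
  shows "operanoid TYPE('m::finite) Z \<longleftrightarrow>
    (\<exists>T :: real^'d \<Rightarrow> real \<Rightarrow> complex^'m^'m.
        (\<forall>x. L1_herm (T x)) \<and> linear_L1 T \<and> (\<forall>x. L1_norm (T x) = support_fun Z x))"
proof
  show "\<exists>T :: real^'d \<Rightarrow> real \<Rightarrow> complex^'m^'m.
      (\<forall>x. L1_herm (T x)) \<and> linear_L1 T \<and> (\<forall>x. L1_norm (T x) = support_fun Z x)"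
    if "operanoid TYPE('m) Z"
    using operanoid_imp_L1_embedding[OF assms that] .
next
  assume "\<exists>T :: real^'d \<Rightarrow> real \<Rightarrow> complex^'m^'m.
      (\<forall>x. L1_herm (T x)) \<and> linear_L1 T \<and> (\<forall>x. L1_norm (T x) = support_fun Z x)"
  then obtain T :: "real^'d \<Rightarrow> real \<Rightarrow> complex^'m^'m" where
    "\<And>x. L1_herm (T x)" "linear_L1 T" "\<And>x. L1_norm (T x) = support_fun Z x"
    by blast
  from L1_embedding_imp_operatope_near[OF assms(1) this]
  show "operanoid TYPE('m) Z"
  proof (intro operanoidI assms(1))
    show "centrally_symmetric Z"
      unfolding centrally_symmetric_def using assms(2) by (intro exI[of _ 0]) simp
  qed
qed

end
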